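(* The feasibility problem for semidefinite programming belongs to $\mathrm{NP}_{\mathbb{R}}\cap\mathrm{co\text{-}NP}_{\mathbb{R}}$ in the Blum–Shub–Smale model of computation over $\mathbb{R}$.
   Context: Let $\mathcal{S}^d$ denote the space of real symmetric $d\times d$ matrices and $\mathcal{S}^d_+\subset\mathcal{S}^d$ the cone of positive semidefinite matrices. The feasibility problem for semidefinite programming is the following decision problem: given symmetric matrices $A_0,A_1,\ldots,A_n\in\mathcal{S}^d$ with real entries, defining the affine space $L=A_0+\operatorname{span}(A_1,\ldots,A_n)$ with $A_1,\ldots,A_n$ linearly independent, decide whether $\mathcal{S}^d_+\cap L\neq\emptyset$, i.e. whether there is $x\in\mathbb{R}^n$ such that $A_0+x_1A_1+\cdots+x_nA_n$ is positive semidefinite. The size of an input is the number of real numbers in it. In the Blum–Shub–Smale model over $\mathbb{R}$, each real number is stored in one unit and each arithmetic operation and comparison of real numbers has unit cost. $\mathrm{NP}_{\mathbb{R}}$ is the class of decision problems whose yes-instances admit real-vector certificates of size polynomial in the input size, checkable in polynomial time in this model; $\mathrm{co\text{-}NP}_{\mathbb{R}}$ is the class of problems whose complement is in $\mathrm{NP}_{\mathbb{R}}$. *)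

theory Defs
  imports
    Complex_Main
    "HOL-Computational_Algebra.Polynomial"
    "Jordan_Normal_Form.Matrix"
begin

section \<open>Blum--Shub--Smale machines over the reals\<close>

text \<open>
  A machine is a finite list of instructions acting on registers \<open>mem 0, mem 1, \<dots>\<close>, each
  holding one real number, and on two address registers \<open>rd\<close> and \<open>wr\<close>, which are used only by
  the copy instruction (the ``fifth node'' of Blum, Shub and Smale).  Arithmetic and tests refer
  to fixed register numbers, and arbitrary real constants may occur in a program.  Every
  instruction has unit cost.
\<close>

datatype arith_op = Add | Sub | Mul | Div

datatype instr =
    Const nat real                \<comment> \<open>\<open>mem r := c\<close>\<close>
  | Arith arith_op nat nat nat    \<comment> \<open>\<open>mem r := mem a \<circ> mem b\<close>\<close>
  | Branch nat nat                \<comment> \<open>if \<open>mem r \<ge> 0\<close> go to instruction \<open>l\<close>\<close>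
  | Copy                          \<comment> \<open>\<open>mem wr := mem rd\<close>\<close>
  | Reset_Rd | Inc_Rd
  | Reset_Wr | Inc_Wr

text \<open>
  As each machine has its own input map, it may choose a number of work registers: the input
  word is stored after these, and register 0 initially holds its length.
\<close>

record bss_machine =
  prog :: "instr list"
  work :: nat

record config =
  pc :: nat
  rd :: nat
  wr :: nat
  mem :: "nat \<Rightarrow> real"

definition init_config :: "bss_machine \<Rightarrow> real list \<Rightarrow> config" where
  "init_config M u =
     \<lparr>pc = 0, rd = 0, wr = 0,
      mem = (\<lambda>a. if a = 0 then real (length u)
                 else if a \<le> work M then 0
                 else if a - Suc (work M) < length u then u ! (a - Suc (work M))
                 else 0)\<rparr>"

fun arith :: "arith_op \<Rightarrow> real \<Rightarrow> real \<Rightarrow> real" where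
  "arith Add x y = x + y"
| "arith Sub x y = x - y"
| "arith Mul x y = x * y"
| "arith Div x y = x / y"

text \<open>
  Division by zero is undefined in the model; here such an instruction leaves the configuration
  unchanged, so that the computation never halts.
\<close>

fun exec :: "instr \<Rightarrow> config \<Rightarrow> config" where
  "exec (Const r c) s = s\<lparr>pc := Suc (pc s), mem := (mem s)(r := c)\<rparr>"
| "exec (Arith f r a b) s =
     (if f = Div \<and> mem s b = 0 then s
      else s\<lparr>pc := Suc (pc s), mem := (mem s)(r := arith f (mem s a) (mem s b))\<rparr>)"
| "exec (Branch r l) s = s\<lparr>pc := (if mem s r \<ge> 0 then l else Suc (pc s))\<rparr>"
| "exec Copy s = s\<lparr>pc := Suc (pc s), mem := (mem s)(wr s := mem s (rd s))\<rparr>"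
| "exec Reset_Rd s = s\<lparr>pc := Suc (pc s), rd := 0\<rparr>"
| "exec Inc_Rd s = s\<lparr>pc := Suc (pc s), rd := Suc (rd s)\<rparr>"
| "exec Reset_Wr s = s\<lparr>pc := Suc (pc s), wr := 0\<rparr>"
| "exec Inc_Wr s = s\<lparr>pc := Suc (pc s), wr := Suc (wr s)\<rparr>"

definition halted :: "bss_machine \<Rightarrow> config \<Rightarrow> bool" where
  "halted M s \<longleftrightarrow> pc s \<ge> length (prog M)"

definition step :: "bss_machine \<Rightarrow> config \<Rightarrow> config" where
  "step M s = (if halted M s then s else exec (prog M ! pc s) s)"

text \<open>Halted configurations are fixed by \<^const>\<open>step\<close>, so \<open>t\<close> is an upper bound on the time.\<close>

definition outputs_within :: "bss_machine \<Rightarrow> real list \<Rightarrow> nat \<Rightarrow> real \<Rightarrow> bool" where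
  "outputs_within M u t v \<longleftrightarrow>
     (let s = (step M ^^ t) (init_config M u) in halted M s \<and> mem s 0 = v)"


section \<open>Complexity classes\<close>

text \<open>
  A decision problem is a pair \<open>(B, A)\<close> of a set \<open>B\<close> of instances and a set \<open>A \<subseteq> B\<close> of
  yes-instances, all instances being finite words of real numbers.  The size of a word is its
  length.
\<close>

type_synonym decision_problem = "real list set \<times> real list set"

definition P_R :: "decision_problem set" where
  "P_R = {(B, A). A \<subseteq> B \<and>
     (\<exists>M (p :: nat poly). \<forall>u\<in>B.
        outputs_within M u (poly p (length u)) (if u \<in> A then 1 else 0))}"

definition pair_word :: "real list \<Rightarrow> real list \<Rightarrow> real list" where
  "pair_word u w = real (length u) # u @ w"

definition NP_R :: "decision_problem set" where
  "NP_R = {(B, A). A \<subseteq> B \<and>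
     (\<exists>V (q :: nat poly).
        ({pair_word u w | u w. u \<in> B}, V) \<in> P_R \<and>
        (\<forall>u\<in>B. u \<in> A \<longleftrightarrow> (\<exists>w. length w \<le> poly q (length u) \<and> pair_word u w \<in> V)))}"

definition complement :: "decision_problem \<Rightarrow> decision_problem" where
  "complement X = (fst X, fst X - snd X)"

definition coNP_R :: "decision_problem set" where
  "coNP_R = {(B, A). A \<subseteq> B \<and> complement (B, A) \<in> NP_R}"


section \<open>The semidefinite feasibility problem\<close>

definition sym_mats :: "nat \<Rightarrow> real mat set" where
  "sym_mats d = {A \<in> carrier_mat d d. transpose_mat A = A}"

definition psd_cone :: "nat \<Rightarrow> real mat set" where
  "psd_cone d = {A \<in> sym_mats d. \<forall>v\<in>carrier_vec d. v \<bullet> (A *\<^sub>v v) \<ge> 0}"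

definition lin_comb :: "nat \<Rightarrow> real mat list \<Rightarrow> real vec \<Rightarrow> real mat" where
  "lin_comb d As x = mat d d (\<lambda>ij. \<Sum>k<length As. x $ k * (As ! k) $$ ij)"

definition lin_indep_mats :: "nat \<Rightarrow> real mat list \<Rightarrow> bool" where
  "lin_indep_mats d As \<longleftrightarrow>
     (\<forall>x\<in>carrier_vec (length As). lin_comb d As x = 0\<^sub>m d d \<longrightarrow> x = 0\<^sub>v (length As))"

definition affine_space :: "nat \<Rightarrow> real mat \<Rightarrow> real mat list \<Rightarrow> real mat set" where
  "affine_space d A0 As = {A0 + lin_comb d As x | x. x \<in> carrier_vec (length As)}"

text \<open>The list \<open>As\<close> consists of the matrices \<open>A\<^sub>1, \<dots>, A\<^sub>n\<close>.\<close>

definition sdp_instance :: "nat \<Rightarrow> real mat \<Rightarrow> real mat list \<Rightarrow> bool" where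
  "sdp_instance d A0 As \<longleftrightarrow>
     A0 \<in> sym_mats d \<and> set As \<subseteq> sym_mats d \<and> lin_indep_mats d As"

text \<open>
  The header \<open>d, n\<close> makes the encoding injective; it is followed by the \<open>(n + 1) d\<^sup>2\<close> entries of
  the matrices, each one written row by row.
\<close>

definition encode_sdp :: "nat \<Rightarrow> real mat \<Rightarrow> real mat list \<Rightarrow> real list" where
  "encode_sdp d A0 As =
     real d # real (length As) # concat (map (\<lambda>A. concat (mat_to_list A)) (A0 # As))"

definition SDP_feasibility :: decision_problem where
  "SDP_feasibility =
     ({encode_sdp d A0 As | d A0 As. sdp_instance d A0 As},
      {encode_sdp d A0 As | d A0 As. sdp_instance d A0 As \<and>
         psd_cone d \<inter> affine_space d A0 As \<noteq> {}})"

end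

theory Submission
  imports Defs "HOL-Library.Function_Algebras" "HOL-Analysis.Product_Vector"
begin

text \<open>
  Membership in \<^const>\<open>NP_R\<close> is obtained for both the problem and its complement in the same way:
  the yes-instances are those for which some real vector solves a system of polynomial
  equations of polynomial size, whose shape depends only on the header \<open>d, n\<close> of the instance.
  Over the reals a system of equations is one equation, namely that the sum of the squares
  vanishes. A verifier therefore has to evaluate a single expression, built from letters of
  the input by sums, products and sums over index ranges, and to compare its value with \<open>0\<close>.
  Expressions of this kind are compiled to machines once and for all (\<open>rcode_correct\<close>,
  \<open>rexp_decidable\<close>), and \<open>NP_R_rexpI\<close> reduces the theorem to the two characterisations.

  Write \<open>A(x) = A\<^sub>0 + x\<^sub>1 A\<^sub>1 + \<dots> + x\<^sub>n A\<^sub>n\<close>. A feasible instance is certified by \<open>x\<close> and a matrix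
  \<open>P\<close> with \<open>A(x) = P P\<^sup>T\<close>; such a factor exists for every positive semidefinite matrix
  (\<open>psd_is_gram\<close>).

  An infeasible instance is certified by a facial reduction. Let \<open>X = A(x)\<close> be positive
  semidefinite. If \<open>P P\<^sup>T\<close> is orthogonal to all \<open>A\<^sub>j\<close>, then it is orthogonal to \<open>X\<close>, and this
  forces \<open>X P = 0\<close>. Once \<open>X S = 0\<close> is known for some \<open>S\<close>, every matrix \<open>R\<close> gives a functional
  \<open>R \<bullet> (X S)\<close>, with \<open>\<bullet>\<close> the entrywise inner product, which vanishes at \<open>X\<close>; so it suffices
  that \<open>P P\<^sup>T \<bullet> A\<^sub>j + R \<bullet> (A\<^sub>j S) = 0\<close> for all \<open>j\<close> in order to conclude \<open>X P = 0\<close> again, and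
  \<open>P P\<^sup>T\<close> may be added to \<open>S\<close>. If finally the same expression is \<open>-1\<close> for \<open>j = 0\<close> and \<open>0\<close> for
  \<open>j \<ge> 1\<close>, then \<open>P P\<^sup>T \<bullet> X = -1\<close>, which is absurd (\<open>infeasibility_certificate_sound\<close>).

  Conversely, in an infeasible instance such a step always exists (\<open>facial_step\<close>): the
  subspace spanned by the pairs \<open>(A\<^sub>j, \<delta>\<^sub>j\<^sub>0)\<close>, cut down to the matrices \<open>X\<close> with \<open>X S = 0\<close>,
  misses the open convex cone of pairs \<open>(X, t)\<close> with \<open>t > 0\<close> and \<open>X\<close> positive definite on the
  kernel of \<open>S\<close>, and a functional separating the two yields \<open>P\<close> and \<open>R\<close>. A step that does not
  finish contributes a nonzero vector orthogonal to those of all earlier steps, so that at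
  most \<open>d\<close> of them occur (\<open>infeasibility_certificate_complete\<close>) and the certificate has
  polynomial size.
\<close>

section \<open>Running times of machine code\<close>

text \<open>
  Only an upper bound on the number of steps is recorded: costs can then be rounded up to a
  polynomial at any point of a computation.
\<close>

definition reaches :: "bss_machine \<Rightarrow> nat \<Rightarrow> config \<Rightarrow> config \<Rightarrow> bool" where
  "reaches M T s s' \<longleftrightarrow> (\<exists>t\<le>T. (step M ^^ t) s = s')"

lemma reaches_refl: "reaches M 0 s s"
  by (simp add: reaches_def)

lemma reaches_trans:
  assumes "reaches M T s s'" "reaches M U s' s''"
  shows "reaches M (T + U) s s''"
proof -
  obtain t u where "t \<le> T" "(step M ^^ t) s = s'" "u \<le> U" "(step M ^^ u) s' = s''"
    using assms by (auto simp: reaches_def)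
  then have "(step M ^^ (u + t)) s = s''" "u + t \<le> T + U"
    by (simp_all add: funpow_add)
  then show ?thesis by (auto simp: reaches_def)
qed

lemma reaches_mono: "reaches M T s s' \<Longrightarrow> T \<le> U \<Longrightarrow> reaches M U s s'"
  by (auto simp: reaches_def intro: order_trans)

definition code_at :: "bss_machine \<Rightarrow> nat \<Rightarrow> instr list \<Rightarrow> bool" where
  "code_at M l cs \<longleftrightarrow> (\<exists>xs ys. prog M = xs @ cs @ ys \<and> length xs = l)"

lemma code_at_append:
  assumes "code_at M l (cs @ ds)"
  shows "code_at M l cs" "code_at M (l + length cs) ds"
proof -
  obtain xs ys where "prog M = xs @ (cs @ ds) @ ys" "length xs = l"
    using assms by (auto simp: code_at_def)
  then have "prog M = xs @ cs @ (ds @ ys)" "prog M = (xs @ cs) @ ds @ ys"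
    "length xs = l" "length (xs @ cs) = l + length cs" by simp_all
  then show "code_at M l cs" "code_at M (l + length cs) ds"
    unfolding code_at_def by blast+
qed

lemma code_at_Cons: "code_at M l (i # cs) \<Longrightarrow> code_at M (Suc l) cs"
  using code_at_append(2)[of M l "[i]" cs] by simp

lemma reaches_instr:
  assumes "code_at M (pc s) (i # cs)"
  shows "reaches M 1 s (exec i s)"
proof -
  obtain xs ys where "prog M = xs @ (i # cs) @ ys" "length xs = pc s"
    using assms by (auto simp: code_at_def)
  then have "step M s = exec i s"
    by (auto simp: step_def halted_def nth_append)
  then show ?thesis by (auto simp: reaches_def intro!: exI[of _ 1])
qed

lemma reaches_Cons:
  assumes "code_at M (pc s) (i # cs)" "reaches M T (exec i s) s'"
  shows "reaches M (Suc T) s s'"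
  using reaches_trans[OF reaches_instr[OF assms(1)] assms(2)] by simp

lemma reaches_Inc_Rd:
  "code_at M (pc s) (replicate k Inc_Rd) \<Longrightarrow>
   reaches M k s (s\<lparr>pc := pc s + k, rd := rd s + k\<rparr>)"
proof (induction k arbitrary: s)
  case 0
  then show ?case by (simp add: reaches_refl)
next
  case (Suc k)
  let ?s = "exec Inc_Rd s"
  have c: "code_at M (pc s) (Inc_Rd # replicate k Inc_Rd)" using Suc.prems by simp
  have "reaches M k ?s (?s\<lparr>pc := pc ?s + k, rd := rd ?s + k\<rparr>)"
    by (rule Suc.IH) (use code_at_Cons[OF c] in simp)
  then show ?case using reaches_Cons[OF c] by simp
qed

lemma reaches_Inc_Wr:
  "code_at M (pc s) (replicate k Inc_Wr) \<Longrightarrow>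
   reaches M k s (s\<lparr>pc := pc s + k, wr := wr s + k\<rparr>)"
proof (induction k arbitrary: s)
  case 0
  then show ?case by (simp add: reaches_refl)
next
  case (Suc k)
  let ?s = "exec Inc_Wr s"
  have c: "code_at M (pc s) (Inc_Wr # replicate k Inc_Wr)" using Suc.prems by simp
  have "reaches M k ?s (?s\<lparr>pc := pc ?s + k, wr := wr ?s + k\<rparr>)"
    by (rule Suc.IH) (use code_at_Cons[OF c] in simp)
  then show ?case using reaches_Cons[OF c] by simp
qed

text \<open>
  A loop that runs \<open>body\<close> as often as the natural number in register \<open>c\<close> says. The scratch
  register \<open>u\<close> is loaded with \<open>1\<close>, which serves both as the decrement and, being nonnegative,
  as the condition of an unconditional jump. It is loaded again after \<open>body\<close>, which may have
  overwritten it. The code is placed at address \<open>l\<close>, hence \<open>body\<close> at \<open>l + 4\<close>.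
\<close>

definition countdown :: "nat \<Rightarrow> nat \<Rightarrow> nat \<Rightarrow> instr list \<Rightarrow> instr list" where
  "countdown c u l body =
     [Const u 1, Arith Sub c c u, Branch c (l + 4), Branch u (l + 6 + length body)]
     @ body @ [Const u 1, Branch u l]"

lemma length_countdown [simp]: "length (countdown c u l body) = length body + 6"
  by (simp add: countdown_def)

lemma code_at_countdown:
  assumes "code_at M l (countdown c u l body)"
  shows "code_at M (l + 4) (body @ [Const u 1, Branch u l])"
  using code_at_append(2)[OF assms[unfolded countdown_def]] by (simp add: numeral_eq_Suc)

text \<open>
  Condition \<open>stable\<close> says that the invariant depends neither on the counter nor on the scratch
  register nor on the program counter, so that it survives the bookkeeping of the loop. The
  generalisation to a start in round \<open>k\<close> with \<open>m\<close> rounds left is what the induction needs.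
\<close>

lemma countdown_loop:
  assumes code: "code_at M l (countdown c u l body)" and "c \<noteq> u"
    and stable: "\<And>k s m p. Inv k s \<Longrightarrow> (\<And>a. a \<noteq> c \<Longrightarrow> a \<noteq> u \<Longrightarrow> m a = mem s a) \<Longrightarrow>
                   Inv k (s\<lparr>mem := m, pc := p\<rparr>)"
    and body: "\<And>k s. Inv k s \<Longrightarrow> k < N \<Longrightarrow> pc s = l + 4 \<Longrightarrow>
                 \<exists>s'. reaches M T s s' \<and> pc s' = l + 4 + length body \<and>
                      mem s' c = mem s c \<and> Inv (Suc k) s'"
  shows "Inv k s \<Longrightarrow> mem s c = real m \<Longrightarrow> k + m = N \<Longrightarrow> pc s = l \<Longrightarrow>
         \<exists>s'. reaches M (m * (T + 6) + 4) s s' \<and> pc s' = l + (length body + 6) \<and> Inv N s'"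
proof (induction m arbitrary: k s)
  note parts = code[unfolded countdown_def]
  have c0: "code_at M l ([Const u 1, Arith Sub c c u, Branch c (l + 4),
      Branch u (l + 6 + length body)])" using code_at_append(1)[OF parts] .
  have rest: "code_at M (l + 4) (body @ [Const u 1, Branch u l])"
    using code_at_countdown[OF code] .
  have c4: "code_at M (l + 4 + length body) [Const u 1, Branch u l]"
    using code_at_append(2)[OF rest] by simp
  have c1: "code_at M (Suc l) [Arith Sub c c u, Branch c (l + 4),
      Branch u (l + 6 + length body)]" using code_at_Cons[OF c0] .
  have c2: "code_at M (Suc (Suc l)) [Branch c (l + 4), Branch u (l + 6 + length body)]"
    using code_at_Cons[OF c1] .
  have c3: "code_at M (Suc (Suc (Suc l))) [Branch u (l + 6 + length body)]"
    using code_at_Cons[OF c2] .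
  have c5: "code_at M (Suc (l + 4 + length body)) [Branch u l]"
    using code_at_Cons[OF c4] .
  {
    case 0
    let ?m = "(mem s)(u := 1, c := -1)"
    let ?s = "s\<lparr>mem := ?m, pc := l + 6 + length body\<rparr>"
    have "reaches M (Suc (Suc (Suc (Suc 0)))) s ?s"
    proof (rule reaches_Cons[of _ _ "Const u 1"])
      show "code_at M (pc s) [Const u 1, Arith Sub c c u, Branch c (l + 4),
          Branch u (l + 6 + length body)]" using c0 0 by simp
    next
      show "reaches M (Suc (Suc (Suc 0))) (exec (Const u 1) s) ?s"
        apply (rule reaches_Cons[of _ _ "Arith Sub c c u"])
        using c1 0 apply simp
        apply (rule reaches_Cons[of _ _ "Branch c (l + 4)"])
        using c2 0 apply simp
        apply (rule reaches_Cons[of _ _ "Branch u (l + 6 + length body)"])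
        using c3 0 \<open>c \<noteq> u\<close> apply simp
        using 0 \<open>c \<noteq> u\<close> by (simp add: reaches_refl)
    qed
    moreover have "Inv N ?s" using 0 by (intro stable) auto
    ultimately show ?case by (intro exI[of _ ?s]) (simp add: numeral_eq_Suc)
  next
    case (Suc m)
    let ?m = "(mem s)(u := 1, c := real m)"
    let ?s = "s\<lparr>mem := ?m, pc := l + 4\<rparr>"
    have r1: "reaches M 3 s ?s"
    proof -
      have "reaches M (Suc (Suc (Suc 0))) s ?s"
        apply (rule reaches_Cons[of _ _ "Const u 1"])
        using c0 Suc apply simp
        apply (rule reaches_Cons[of _ _ "Arith Sub c c u"])
        using c1 Suc apply simp
        apply (rule reaches_Cons[of _ _ "Branch c (l + 4)"])
        using c2 Suc apply simp
        using Suc \<open>c \<noteq> u\<close> by (simp add: reaches_refl)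
      then show ?thesis by (simp add: numeral_eq_Suc)
    qed
    have "Inv k ?s" using Suc by (intro stable) auto
    then obtain s1 where s1: "reaches M T ?s s1" "pc s1 = l + 4 + length body"
        "mem s1 c = mem ?s c" "Inv (Suc k) s1"
      using body[of k ?s] Suc by auto
    let ?s2 = "s1\<lparr>mem := (mem s1)(u := 1), pc := l\<rparr>"
    have "reaches M (Suc (Suc 0)) s1 ?s2"
      apply (rule reaches_Cons[of _ _ "Const u 1"])
      using c4 s1 apply simp
      apply (rule reaches_Cons[of _ _ "Branch u l"])
      using c5 s1 apply simp
      by (simp add: reaches_refl)
    then have r2: "reaches M 2 s1 ?s2" by (simp add: numeral_eq_Suc)
    have "Inv (Suc k) ?s2" using s1 by (intro stable) auto
    then obtain s3 where s3: "reaches M (m * (T + 6) + 4) ?s2 s3"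
        "pc s3 = l + (length body + 6)" "Inv N s3"
      using Suc.IH[of "Suc k" ?s2] Suc.prems s1 \<open>c \<noteq> u\<close> by auto
    have "reaches M (3 + T + 2 + (m * (T + 6) + 4)) s s3"
      using reaches_trans[OF reaches_trans[OF reaches_trans[OF r1 s1(1)] r2] s3(1)] .
    then have "reaches M (Suc m * (T + 6) + 4) s s3"
      by (rule reaches_mono) simp
    then show ?case using s3 by blast
  }
qed

section \<open>Expressions with bounded sums and their compilation\<close>

text \<open>
  Index expressions take natural numbers as values and contain no letters of the input word.
  All addresses and all ranges of sums are thus polynomially bounded in the values of the
  variables, whatever the certificate is.
\<close>

datatype iexp = IConst nat | IVar nat | IAdd iexp iexp | IMul iexp iexp

datatype rexp =
    RConst real
  | RInp iexp
  | RAdd rexp rexp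
  | RMul rexp rexp
  | RSum nat iexp rexp

primrec ival :: "iexp \<Rightarrow> (nat \<Rightarrow> nat) \<Rightarrow> nat" where
  "ival (IConst c) env = c"
| "ival (IVar v) env = env v"
| "ival (IAdd i j) env = ival i env + ival j env"
| "ival (IMul i j) env = ival i env * ival j env"

primrec rval :: "rexp \<Rightarrow> (nat \<Rightarrow> nat) \<Rightarrow> (nat \<Rightarrow> real) \<Rightarrow> real" where
  "rval (RConst c) env y = c"
| "rval (RInp i) env y = y (ival i env)"
| "rval (RAdd e f) env y = rval e env y + rval f env y"
| "rval (RMul e f) env y = rval e env y * rval f env y"
| "rval (RSum v i e) env y = (\<Sum>k<ival i env. rval e (env(v := k)) y)"

text \<open>
  Register \<open>\<rho> v\<close> holds the variable \<open>v\<close>, the result goes to \<open>r\<close>, and the registers from \<open>r\<close> on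
  serve as a stack.
\<close>

primrec icode :: "(nat \<Rightarrow> nat) \<Rightarrow> nat \<Rightarrow> iexp \<Rightarrow> instr list" where
  "icode \<rho> r (IConst c) = [Const r (real c)]"
| "icode \<rho> r (IVar v) = [Const r 0, Arith Add r r (\<rho> v)]"
| "icode \<rho> r (IAdd i j) = icode \<rho> r i @ icode \<rho> (Suc r) j @ [Arith Add r r (Suc r)]"
| "icode \<rho> r (IMul i j) = icode \<rho> r i @ icode \<rho> (Suc r) j @ [Arith Mul r r (Suc r)]"

primrec iwidth :: "iexp \<Rightarrow> nat" where
  "iwidth (IConst c) = 1"
| "iwidth (IVar v) = 1"
| "iwidth (IAdd i j) = Suc (iwidth i + iwidth j)"
| "iwidth (IMul i j) = Suc (iwidth i + iwidth j)"

primrec icost :: "iexp \<Rightarrow> nat" where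
  "icost (IConst c) = 1"
| "icost (IVar v) = 2"
| "icost (IAdd i j) = Suc (icost i + icost j)"
| "icost (IMul i j) = Suc (icost i + icost j)"

primrec ibound :: "iexp \<Rightarrow> nat poly" where
  "ibound (IConst c) = [:c:]"
| "ibound (IVar v) = [:0, 1:]"
| "ibound (IAdd i j) = ibound i + ibound j"
| "ibound (IMul i j) = ibound i * ibound j"

text \<open>
  The address register \<open>rd\<close> can only be reset and incremented, so reading the letter whose
  number is in register \<open>r\<close> takes a loop. The first \<open>Suc K\<close> increments skip register \<open>0\<close> and
  the \<open>K\<close> work registers, which precede the input word.
\<close>

definition fetch :: "nat \<Rightarrow> nat \<Rightarrow> nat \<Rightarrow> instr list" where
  "fetch K r l =
     Reset_Rd # replicate (Suc K) Inc_Rd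
     @ countdown r (Suc r) (l + Suc (Suc K)) [Inc_Rd]
     @ Reset_Wr # replicate r Inc_Wr @ [Copy]"

text \<open>
  Jumps are absolute, hence the argument \<open>l\<close>, the address of the first instruction. In a sum,
  register \<open>r\<close> accumulates the result, \<open>r + 1\<close> counts the remaining rounds, \<open>r + 2\<close> is the
  index and becomes the register of the bound variable, and \<open>r + 3\<close> receives the summand and,
  between two rounds, the constant \<open>1\<close>.
\<close>

primrec rcode :: "nat \<Rightarrow> rexp \<Rightarrow> (nat \<Rightarrow> nat) \<Rightarrow> nat \<Rightarrow> nat \<Rightarrow> instr list" where
  "rcode K (RConst c) \<rho> r l = [Const r c]"
| "rcode K (RInp i) \<rho> r l = icode \<rho> r i @ fetch K r (l + length (icode \<rho> r i))"
| "rcode K (RAdd e f) \<rho> r l =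
     (let c1 = rcode K e \<rho> r l; c2 = rcode K f \<rho> (Suc r) (l + length c1)
      in c1 @ c2 @ [Arith Add r r (Suc r)])"
| "rcode K (RMul e f) \<rho> r l =
     (let c1 = rcode K e \<rho> r l; c2 = rcode K f \<rho> (Suc r) (l + length c1)
      in c1 @ c2 @ [Arith Mul r r (Suc r)])"
| "rcode K (RSum v i e) \<rho> r l =
     (let c1 = icode \<rho> (r + 1) i; l' = l + length c1 + 2
      in c1 @ [Const r 0, Const (r + 2) 0]
         @ countdown (r + 1) (r + 3) l'
             (rcode K e (\<rho>(v := r + 2)) (r + 3) (l' + 4)
              @ [Arith Add r r (r + 3), Const (r + 3) 1, Arith Add (r + 2) (r + 2) (r + 3)]))"

primrec rwidth :: "rexp \<Rightarrow> nat" where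
  "rwidth (RConst c) = 1"
| "rwidth (RInp i) = iwidth i + 2"
| "rwidth (RAdd e f) = Suc (rwidth e + rwidth f)"
| "rwidth (RMul e f) = Suc (rwidth e + rwidth f)"
| "rwidth (RSum v i e) = iwidth i + rwidth e + 4"

text \<open>
  The running time as a polynomial in a common bound on the values of the variables. Inside a
  sum that bound has to be enlarged by the range of the index, which is the reason for the
  composition.
\<close>

primrec rcost :: "nat \<Rightarrow> rexp \<Rightarrow> nat poly" where
  "rcost K (RConst c) = [:1:]"
| "rcost K (RInp i) = [:icost i + 2 * K + 8:] + [:7:] * ibound i"
| "rcost K (RAdd e f) = rcost K e + rcost K f + [:1:]"
| "rcost K (RMul e f) = rcost K e + rcost K f + [:1:]"
| "rcost K (RSum v i e) =
     [:icost i + 6:] + ibound i * ([:9:] + rcost K e \<circ>\<^sub>p ([:0, 1:] + ibound i))"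

lemma ival_le_ibound: "(\<And>v. env v \<le> m) \<Longrightarrow> ival i env \<le> poly (ibound i) m"
  by (induction i) (auto intro: add_mono mult_mono)

text \<open>
  The registers that may change are those from \<open>r\<close> to \<open>r + w - 1\<close>; neither the registers of
  the variables nor the input word lie in this window.
\<close>

definition frame :: "nat \<Rightarrow> nat \<Rightarrow> config \<Rightarrow> config \<Rightarrow> bool" where
  "frame r w s s' \<longleftrightarrow> (\<forall>a. a < r \<or> r + w \<le> a \<longrightarrow> mem s' a = mem s a)"

lemma frameD: "frame r w s s' \<Longrightarrow> a < r \<or> r + w \<le> a \<Longrightarrow> mem s' a = mem s a"
  by (auto simp: frame_def)

text \<open>
  The second operand is evaluated one register higher on the stack, so it leaves the first one
  alone.
\<close>

lemma code_binary:
  assumes "code_at M (pc s) (c1 @ c2 @ [Arith f r r (Suc r)])" and "f \<noteq> Div"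
    and "reaches M T1 s s1" "pc s1 = pc s + length c1" "mem s1 r = x" "frame r w1 s s1"
    and "reaches M T2 s1 s2" "pc s2 = pc s1 + length c2" "mem s2 (Suc r) = y"
        "frame (Suc r) w2 s1 s2"
  shows "\<exists>s'. reaches M (Suc (T1 + T2)) s s' \<and>
          pc s' = pc s + length (c1 @ c2 @ [Arith f r r (Suc r)]) \<and>
          mem s' r = arith f x y \<and> frame r (Suc (w1 + w2)) s s'"
proof -
  have c: "code_at M (pc s2) [Arith f r r (Suc r)]"
    using code_at_append(2)[OF code_at_append(2)[OF assms(1)]] assms by (simp add: add.assoc)
  have x: "mem s2 r = x" using frameD[OF assms(10), of r] assms by simp
  let ?s = "exec (Arith f r r (Suc r)) s2"
  have "reaches M (T1 + T2 + 1) s ?s"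
    using reaches_trans[OF reaches_trans[OF assms(3) assms(7)] reaches_instr[OF c]] .
  moreover have "frame r (Suc (w1 + w2)) s ?s"
    using assms(2,6,10) by (auto simp: frame_def)
  ultimately show ?thesis using assms x by (intro exI[of _ ?s]) simp
qed

lemma icode_correct:
  assumes "code_at M (pc s) (icode \<rho> r i)"
    and "\<And>v. \<rho> v < r" and "\<And>v. mem s (\<rho> v) = real (env v)"
  shows "\<exists>s'. reaches M (icost i) s s' \<and> pc s' = pc s + length (icode \<rho> r i) \<and>
              mem s' r = real (ival i env) \<and> frame r (iwidth i) s s'"
  using assms
proof (induction i arbitrary: r s)
  case (IConst c)
  let ?s = "exec (Const r (real c)) s"
  have "reaches M 1 s ?s" using IConst by (intro reaches_instr) auto
  then show ?case by (intro exI[of _ ?s]) (auto simp: frame_def)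
next
  case (IVar v)
  let ?s = "exec (Arith Add r r (\<rho> v)) (exec (Const r 0) s)"
  have c: "code_at M (pc s) [Const r 0, Arith Add r r (\<rho> v)]" using IVar by simp
  have ne: "\<rho> v \<noteq> r" using IVar.prems(2)[of v] by simp
  have "reaches M (1 + 1) s ?s"
    by (rule reaches_trans[OF reaches_instr[OF c] reaches_instr])
       (use code_at_Cons[OF c] in simp)
  then show ?case using ne IVar.prems(3)[of v]
    by (intro exI[of _ ?s]) (auto simp: frame_def numeral_eq_Suc)
next
  case (IAdd i j)
  have c: "code_at M (pc s) (icode \<rho> r i @ icode \<rho> (Suc r) j @ [Arith Add r r (Suc r)])"
    using IAdd.prems by simp
  obtain s1 where s1: "reaches M (icost i) s s1" "pc s1 = pc s + length (icode \<rho> r i)"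
      "mem s1 r = real (ival i env)" "frame r (iwidth i) s s1"
    using IAdd.IH(1)[OF code_at_append(1)[OF c] IAdd.prems(2,3)] by blast
  have "\<exists>s2. reaches M (icost j) s1 s2 \<and> pc s2 = pc s1 + length (icode \<rho> (Suc r) j) \<and>
      mem s2 (Suc r) = real (ival j env) \<and> frame (Suc r) (iwidth j) s1 s2"
    by (rule IAdd.IH(2)) (use code_at_append(1)[OF code_at_append(2)[OF c]] s1
        frameD[OF s1(4)] IAdd.prems(2,3) in \<open>auto simp: less_Suc_eq\<close>)
  then obtain s2 where s2: "reaches M (icost j) s1 s2" "pc s2 = pc s1 + length (icode \<rho> (Suc r) j)"
      "mem s2 (Suc r) = real (ival j env)" "frame (Suc r) (iwidth j) s1 s2" by blast
  show ?case using code_binary[OF c _ s1 s2] by simp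
next
  case (IMul i j)
  have c: "code_at M (pc s) (icode \<rho> r i @ icode \<rho> (Suc r) j @ [Arith Mul r r (Suc r)])"
    using IMul.prems by simp
  obtain s1 where s1: "reaches M (icost i) s s1" "pc s1 = pc s + length (icode \<rho> r i)"
      "mem s1 r = real (ival i env)" "frame r (iwidth i) s s1"
    using IMul.IH(1)[OF code_at_append(1)[OF c] IMul.prems(2,3)] by blast
  have "\<exists>s2. reaches M (icost j) s1 s2 \<and> pc s2 = pc s1 + length (icode \<rho> (Suc r) j) \<and>
      mem s2 (Suc r) = real (ival j env) \<and> frame (Suc r) (iwidth j) s1 s2"
    by (rule IMul.IH(2)) (use code_at_append(1)[OF code_at_append(2)[OF c]] s1
        frameD[OF s1(4)] IMul.prems(2,3) in \<open>auto simp: less_Suc_eq\<close>)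
  then obtain s2 where s2: "reaches M (icost j) s1 s2" "pc s2 = pc s1 + length (icode \<rho> (Suc r) j)"
      "mem s2 (Suc r) = real (ival j env)" "frame (Suc r) (iwidth j) s1 s2" by blast
  show ?case using code_binary[OF c _ s1 s2] by simp
qed

lemma fetch_correct:
  assumes code: "code_at M (pc s) (fetch K r (pc s))"
    and "mem s r = real N" and "Suc r \<le> K"
  shows "\<exists>s'. reaches M (7 * N + 2 * K + 8) s s' \<and>
              pc s' = pc s + length (fetch K r (pc s)) \<and>
              mem s' r = mem s (Suc K + N) \<and> frame r 2 s s'"
proof -
  let ?l = "pc s + Suc (Suc K)"
  have c0: "code_at M (pc s) (Reset_Rd # replicate (Suc K) Inc_Rd
      @ (countdown r (Suc r) ?l [Inc_Rd] @ Reset_Wr # replicate r Inc_Wr @ [Copy]))"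
    using code by (simp add: fetch_def)
  note c1 = code_at_Cons[OF c0]
  have c2: "code_at M ?l (countdown r (Suc r) ?l [Inc_Rd] @ Reset_Wr # replicate r Inc_Wr @ [Copy])"
    using code_at_append(2)[OF c1] by (simp only: length_replicate) simp
  have c3: "code_at M (?l + 7) (Reset_Wr # replicate r Inc_Wr @ [Copy])"
    using code_at_append(2)[OF c2] by simp
  note c4 = code_at_Cons[OF c3]
  have c5: "code_at M (Suc (?l + 7) + r) [Copy]"
    using code_at_append(2)[OF c4] by simp
  let ?s1 = "exec Reset_Rd s"
  let ?s2 = "?s1\<lparr>pc := pc ?s1 + Suc K, rd := rd ?s1 + Suc K\<rparr>"
  have r1: "reaches M 1 s ?s1" by (rule reaches_instr[OF c0])
  have r2: "reaches M (Suc K) ?s1 ?s2"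
    by (rule reaches_Inc_Rd) (use code_at_append(1)[OF c1] in simp)
  define Inv where "Inv k t \<longleftrightarrow> rd t = Suc K + k \<and>
      (\<forall>a. a \<noteq> r \<and> a \<noteq> Suc r \<longrightarrow> mem t a = mem s a)" for k and t :: config
  have "\<exists>s'. reaches M (N * (1 + 6) + 4) ?s2 s' \<and> pc s' = ?l + (length [Inc_Rd] + 6) \<and> Inv N s'"
  proof (rule countdown_loop[where k = 0 and Inv = Inv and c = r and u = "Suc r"])
    show "code_at M ?l (countdown r (Suc r) ?l [Inc_Rd])" by (rule code_at_append(1)[OF c2])
    show "\<And>k s m p. Inv k s \<Longrightarrow> (\<And>a. a \<noteq> r \<Longrightarrow> a \<noteq> Suc r \<Longrightarrow> m a = mem s a) \<Longrightarrow>
        Inv k (s\<lparr>mem := m, pc := p\<rparr>)" by (auto simp: Inv_def)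
    show "\<exists>s'. reaches M 1 t s' \<and> pc s' = ?l + 4 + length [Inc_Rd] \<and> mem s' r = mem t r \<and> Inv (Suc k) s'"
      if "Inv k t" "k < N" "pc t = ?l + 4" for k t
    proof -
      have "code_at M (pc t) [Inc_Rd]"
        using code_at_append(1)[OF code_at_countdown[OF code_at_append(1)[OF c2]]] that(3)
        by simp
      then show ?thesis using that reaches_instr[of M t Inc_Rd "[]"]
        by (intro exI[of _ "exec Inc_Rd t"]) (auto simp: Inv_def)
    qed
  qed (use assms in \<open>auto simp: Inv_def\<close>)
  then obtain s3 where s3: "reaches M (N * 7 + 4) ?s2 s3" "pc s3 = ?l + 7" "Inv N s3" by auto
  let ?s4 = "exec Reset_Wr s3"
  let ?s5 = "?s4\<lparr>pc := pc ?s4 + r, wr := wr ?s4 + r\<rparr>"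
  let ?s6 = "exec Copy ?s5"
  have r4: "reaches M 1 s3 ?s4" by (rule reaches_instr) (use c3 s3 in simp)
  have r5: "reaches M r ?s4 ?s5"
    by (rule reaches_Inc_Wr) (use code_at_append(1)[OF c4] s3 in simp)
  have r6: "reaches M 1 ?s5 ?s6" by (rule reaches_instr) (use c5 s3 in simp)
  have "reaches M (1 + Suc K + (N * 7 + 4) + 1 + r + 1) s ?s6"
    by (rule reaches_trans[OF reaches_trans[OF reaches_trans[OF reaches_trans[OF
          reaches_trans[OF r1 r2] s3(1)] r4] r5] r6])
  then have "reaches M (7 * N + 2 * K + 8) s ?s6"
    by (rule reaches_mono) (use assms in simp)
  moreover have "mem ?s6 r = mem s (Suc K + N)" "frame r 2 s ?s6"
    using s3(3) assms(3) by (auto simp: Inv_def frame_def)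
  ultimately show ?thesis using s3(2) by (intro exI[of _ ?s6]) (simp add: fetch_def)
qed

text \<open>
  The window of changed registers ends below the input word, so every subexpression finds the
  word as it was at the start.
\<close>

lemma rcode_correct:
  assumes "code_at M (pc s) (rcode K e \<rho> r (pc s))"
    and "\<And>v. \<rho> v < r" and "\<And>v. mem s (\<rho> v) = real (env v)" and "\<And>v. env v \<le> m"
    and "r + rwidth e \<le> Suc K" and "\<And>i. mem s (Suc K + i) = y i"
  shows "\<exists>s'. reaches M (poly (rcost K e) m) s s' \<and>
              pc s' = pc s + length (rcode K e \<rho> r (pc s)) \<and>
              mem s' r = rval e env y \<and> frame r (rwidth e) s s'"
  using assms
proof (induction e arbitrary: r s \<rho> env m)
  case (RConst c)
  let ?s = "exec (Const r c) s"
  have "reaches M 1 s ?s" using RConst by (intro reaches_instr) auto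
  then show ?case by (intro exI[of _ ?s]) (auto simp: frame_def)
next
  case (RInp i)
  have c: "code_at M (pc s) (icode \<rho> r i @ fetch K r (pc s + length (icode \<rho> r i)))"
    using RInp.prems by simp
  obtain s1 where s1: "reaches M (icost i) s s1" "pc s1 = pc s + length (icode \<rho> r i)"
      "mem s1 r = real (ival i env)" "frame r (iwidth i) s s1"
    using icode_correct[OF code_at_append(1)[OF c] RInp.prems(2,3)] by blast
  obtain s2 where s2: "reaches M (7 * ival i env + 2 * K + 8) s1 s2"
      "pc s2 = pc s1 + length (fetch K r (pc s1))"
      "mem s2 r = mem s1 (Suc K + ival i env)" "frame r 2 s1 s2"
    using fetch_correct[of M s1 K r "ival i env"] code_at_append(2)[OF c] s1 RInp.prems(5) by auto
  have "reaches M (poly (rcost K (RInp i)) m) s s2"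
    by (rule reaches_mono[OF reaches_trans[OF s1(1) s2(1)]])
       (use ival_le_ibound[of env m i, OF RInp.prems(4)] in simp)
  moreover have "mem s1 (Suc K + ival i env) = mem s (Suc K + ival i env)"
    by (rule frameD[OF s1(4)]) (use RInp.prems(5) in simp)
  moreover have "frame r (rwidth (RInp i)) s s2"
    using s1(4) s2(4) by (auto simp: frame_def)
  ultimately show ?case using s1 s2 RInp.prems(6) by (intro exI[of _ s2]) simp
next
  case (RAdd e f)
  let ?c1 = "rcode K e \<rho> r (pc s)"
  let ?c2 = "rcode K f \<rho> (Suc r) (pc s + length ?c1)"
  have c: "code_at M (pc s) (?c1 @ ?c2 @ [Arith Add r r (Suc r)])"
    using RAdd.prems by (simp add: Let_def)
  have "r + rwidth e \<le> Suc K" using RAdd.prems(5) by simp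
  then obtain s1 where s1: "reaches M (poly (rcost K e) m) s s1" "pc s1 = pc s + length ?c1"
      "mem s1 r = rval e env y" "frame r (rwidth e) s s1"
    using RAdd.IH(1)[OF code_at_append(1)[OF c] RAdd.prems(2-4) _ RAdd.prems(6)] by blast
  have c2: "code_at M (pc s1) (rcode K f \<rho> (Suc r) (pc s1))"
    using code_at_append(1)[OF code_at_append(2)[OF c]] s1 by simp
  have "\<exists>s2. reaches M (poly (rcost K f) m) s1 s2 \<and> pc s2 = pc s1 + length ?c2 \<and>
      mem s2 (Suc r) = rval f env y \<and> frame (Suc r) (rwidth f) s1 s2"
    using RAdd.IH(2)[OF c2, of env m] s1 frameD[OF s1(4)] RAdd.prems(2-6)
    by (auto simp: less_Suc_eq)
  then obtain s2 where s2: "reaches M (poly (rcost K f) m) s1 s2" "pc s2 = pc s1 + length ?c2"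
      "mem s2 (Suc r) = rval f env y" "frame (Suc r) (rwidth f) s1 s2" by blast
  show ?case using code_binary[OF c _ s1 s2] by (simp add: Let_def)
next
  case (RMul e f)
  let ?c1 = "rcode K e \<rho> r (pc s)"
  let ?c2 = "rcode K f \<rho> (Suc r) (pc s + length ?c1)"
  have c: "code_at M (pc s) (?c1 @ ?c2 @ [Arith Mul r r (Suc r)])"
    using RMul.prems by (simp add: Let_def)
  have "r + rwidth e \<le> Suc K" using RMul.prems(5) by simp
  then obtain s1 where s1: "reaches M (poly (rcost K e) m) s s1" "pc s1 = pc s + length ?c1"
      "mem s1 r = rval e env y" "frame r (rwidth e) s s1"
    using RMul.IH(1)[OF code_at_append(1)[OF c] RMul.prems(2-4) _ RMul.prems(6)] by blast
  have c2: "code_at M (pc s1) (rcode K f \<rho> (Suc r) (pc s1))"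
    using code_at_append(1)[OF code_at_append(2)[OF c]] s1 by simp
  have "\<exists>s2. reaches M (poly (rcost K f) m) s1 s2 \<and> pc s2 = pc s1 + length ?c2 \<and>
      mem s2 (Suc r) = rval f env y \<and> frame (Suc r) (rwidth f) s1 s2"
    using RMul.IH(2)[OF c2, of env m] s1 frameD[OF s1(4)] RMul.prems(2-6)
    by (auto simp: less_Suc_eq)
  then obtain s2 where s2: "reaches M (poly (rcost K f) m) s1 s2" "pc s2 = pc s1 + length ?c2"
      "mem s2 (Suc r) = rval f env y" "frame (Suc r) (rwidth f) s1 s2" by blast
  show ?case using code_binary[OF c _ s1 s2] by (simp add: Let_def)
next
  case (RSum v i e)
  let ?c1 = "icode \<rho> (r + 1) i"
  let ?l = "pc s + length ?c1 + 2"
  let ?add = "[Arith Add r r (r + 3), Const (r + 3) 1, Arith Add (r + 2) (r + 2) (r + 3)]"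
  let ?ce = "rcode K e (\<rho>(v := r + 2)) (r + 3) (?l + 4)"
  let ?loop = "countdown (r + 1) (r + 3) ?l (?ce @ ?add)"
  let ?w = "rwidth (RSum v i e)"
  let ?N = "ival i env"
  let ?m = "m + poly (ibound i) m"
  let ?T = "poly (rcost K e) ?m + 3"
  have c: "code_at M (pc s) (?c1 @ [Const r 0, Const (r + 2) 0] @ ?loop)"
    using RSum.prems(1) by (simp add: Let_def)
  have "\<exists>s'. reaches M (icost i) s s' \<and> pc s' = pc s + length ?c1 \<and>
              mem s' (r + 1) = real ?N \<and> frame (r + 1) (iwidth i) s s'"
    by (rule icode_correct[OF code_at_append(1)[OF c]])
       (use RSum.prems(2,3) in \<open>auto simp: less_Suc_eq\<close>)
  then obtain s1 where s1: "reaches M (icost i) s s1" "pc s1 = pc s + length ?c1"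
      "mem s1 (r + 1) = real ?N" "frame (r + 1) (iwidth i) s s1" by blast
  have c1: "code_at M (pc s1) ([Const r 0, Const (r + 2) 0] @ ?loop)"
    using code_at_append(2)[OF c] s1 by simp
  let ?s2 = "exec (Const (r + 2) 0) (exec (Const r 0) s1)"
  have r2: "reaches M (1 + 1) s1 ?s2"
    apply (rule reaches_trans[OF reaches_instr reaches_instr])
    using c1 apply simp
    using code_at_Cons[of M "pc s1" "Const r 0" "Const (r + 2) 0 # ?loop"] c1 apply simp
    done
  have c2: "code_at M ?l ?loop" using code_at_append(2)[OF c1] s1 by simp
  have c3: "code_at M (?l + 4) ((?ce @ ?add) @ [Const (r + 3) 1, Branch (r + 3) ?l])"
    using code_at_countdown[OF c2] .
  have ce: "code_at M (?l + 4) ?ce" and cadd: "code_at M (?l + 4 + length ?ce) ?add"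
    using code_at_append[OF code_at_append(1)[OF c3]] by simp_all
  define Inv where "Inv k t \<longleftrightarrow> mem t r = (\<Sum>j<k. rval e (env(v := j)) y) \<and>
      mem t (r + 2) = real k \<and> frame r ?w s t" for k and t :: config
  have "\<exists>s'. reaches M (?N * (?T + 6) + 4) ?s2 s' \<and> pc s' = ?l + (length (?ce @ ?add) + 6) \<and> Inv ?N s'"
  proof (rule countdown_loop[where k = 0 and Inv = Inv and c = "r + 1" and u = "r + 3"])
    show "code_at M ?l ?loop" by (rule c2)
    show "\<And>k s m p. Inv k s \<Longrightarrow> (\<And>a. a \<noteq> r + 1 \<Longrightarrow> a \<noteq> r + 3 \<Longrightarrow> m a = mem s a) \<Longrightarrow>
        Inv k (s\<lparr>mem := m, pc := p\<rparr>)" by (auto simp: Inv_def frame_def)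
    show "\<exists>s'. reaches M ?T t s' \<and> pc s' = ?l + 4 + length (?ce @ ?add) \<and>
            mem s' (r + 1) = mem t (r + 1) \<and> Inv (Suc k) s'"
      if t: "Inv k t" "k < ?N" "pc t = ?l + 4" for k t
    proof -
      have small: "mem t a = mem s a" if "a < r \<or> r + ?w \<le> a" for a
        using t(1) frameD[of r ?w s t a] that by (simp add: Inv_def)
      have "\<exists>s'. reaches M (poly (rcost K e) ?m) t s' \<and> pc s' = pc t + length (rcode K e (\<rho>(v := r + 2)) (r + 3) (pc t)) \<and>
              mem s' (r + 3) = rval e (env(v := k)) y \<and> frame (r + 3) (rwidth e) t s'"
      proof (rule RSum.IH)
        show "code_at M (pc t) (rcode K e (\<rho>(v := r + 2)) (r + 3) (pc t))" using ce t(3) by simp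
        show "(\<rho>(v := r + 2)) v' < r + 3" for v' using RSum.prems(2)[of v'] by simp
        show "mem t ((\<rho>(v := r + 2)) v') = real ((env(v := k)) v')" for v'
          using t(1) small[of "\<rho> v'"] RSum.prems(2,3)[of v'] by (simp add: Inv_def)
        show "(env(v := k)) v' \<le> ?m" for v'
          using RSum.prems(4)[of v'] t(2) ival_le_ibound[of env m i, OF RSum.prems(4)] by simp
        show "r + 3 + rwidth e \<le> Suc K" using RSum.prems(5) by simp
        show "mem t (Suc K + i) = y i" for i
          using small[of "Suc K + i"] RSum.prems(5) RSum.prems(6)[of i] by simp
      qed
      then obtain t1 where t1: "reaches M (poly (rcost K e) ?m) t t1"
          "pc t1 = ?l + 4 + length ?ce" "mem t1 (r + 3) = rval e (env(v := k)) y"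
          "frame (r + 3) (rwidth e) t t1" using t(3) by auto
      let ?t2 = "exec (Arith Add r r (r + 3)) t1"
      let ?t3 = "exec (Const (r + 3) 1) ?t2"
      let ?t4 = "exec (Arith Add (r + 2) (r + 2) (r + 3)) ?t3"
      have "reaches M (Suc (Suc (Suc 0))) t1 ?t4"
        apply (rule reaches_Cons[of _ _ "Arith Add r r (r + 3)"])
        using cadd t1 apply simp
        apply (rule reaches_Cons[of _ _ "Const (r + 3) 1"])
        using code_at_Cons[OF cadd] t1 apply simp
        apply (rule reaches_Cons[of _ _ "Arith Add (r + 2) (r + 2) (r + 3)"])
        using code_at_Cons[OF code_at_Cons[OF cadd]] t1 apply simp
        by (rule reaches_refl)
      then have "reaches M 3 t1 ?t4" by (simp only: numeral_3_eq_3)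
      with t1(1) have "reaches M ?T t ?t4" by (rule reaches_trans)
      moreover have "mem t1 r = mem t r" "mem t1 (r + 1) = mem t (r + 1)" "mem t1 (r + 2) = mem t (r + 2)"
        using frameD[OF t1(4)] by simp_all
      moreover have "frame r ?w s ?t4"
        using t1(4) small by (auto simp: frame_def)
      ultimately show ?thesis using t t1(2,3)
        by (intro exI[of _ ?t4]) (auto simp: Inv_def)
    qed
    show "Inv 0 ?s2" using s1(4) by (auto simp: Inv_def frame_def)
    show "pc ?s2 = ?l" using s1 by simp
    show "mem ?s2 (r + 1) = real ?N" using s1 by simp
  qed simp_all
  then obtain s3 where s3: "reaches M (?N * (?T + 6) + 4) ?s2 s3"
      "pc s3 = ?l + (length (?ce @ ?add) + 6)" "Inv ?N s3" by blast
  have "?N * (?T + 6) \<le> poly (ibound i) m * (?T + 6)"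
    using ival_le_ibound[of env m i, OF RSum.prems(4)] by (rule mult_right_mono) simp
  then have "icost i + (1 + 1) + (?N * (?T + 6) + 4) \<le> poly (rcost K (RSum v i e)) m"
    by (simp add: poly_pcompose algebra_simps)
  then have "reaches M (poly (rcost K (RSum v i e)) m) s s3"
    using reaches_mono[OF reaches_trans[OF reaches_trans[OF s1(1) r2] s3(1)]] by blast
  then show ?case using s3(2,3) by (intro exI[of _ s3]) (simp add: Inv_def Let_def)
qed

section \<open>Verification in polynomial time by expressions\<close>

lemma reaches_halted:
  assumes "reaches M T s s'" "halted M s'"
  shows "(step M ^^ T) s = s'"
proof -
  obtain t where t: "t \<le> T" "(step M ^^ t) s = s'" using assms by (auto simp: reaches_def)
  have "(step M ^^ k) s' = s'" for k
    by (induction k) (use assms(2) in \<open>simp_all add: step_def\<close>)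
  moreover have "(step M ^^ T) s = (step M ^^ (T - t)) ((step M ^^ t) s)"
    using t(1) by (simp flip: funpow_add[THEN fun_cong, simplified o_apply])
  ultimately show ?thesis using t by simp
qed

text \<open>
  The memory behind the input word is zero, so a certificate that is too short reads as if it
  were padded with zeros.
\<close>

definition padded :: "real list \<Rightarrow> nat \<Rightarrow> real" where
  "padded y i = (if i < length y then y ! i else 0)"

text \<open>
  The variables \<open>0\<close> and \<open>1\<close> of the verifying expressions stand for the dimension and the
  number of matrices.
\<close>

definition header :: "nat \<Rightarrow> nat \<Rightarrow> nat \<Rightarrow> nat" where
  "header d n = (\<lambda>_. 0)(0 := d, 1 := n)"

text \<open>
  The machine reads \<open>d\<close> and \<open>n\<close> from letters \<open>1\<close> and \<open>2\<close> of the word, since letter \<open>0\<close> of a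
  pair is the length of its first component; it keeps them in registers \<open>1\<close> and \<open>2\<close>, and lets
  register \<open>3\<close> serve all other variables. The test for \<open>\<ge> 0\<close> is applied to the negated value
  of the expression.
\<close>

lemma rexp_decidable:
  obtains M :: bss_machine and p :: "nat poly" where
    "\<And>y d n. padded y 1 = real d \<Longrightarrow> padded y 2 = real n \<Longrightarrow> d \<le> length y \<Longrightarrow> n \<le> length y \<Longrightarrow>
       outputs_within M y (poly p (length y)) (if rval e (header d n) (padded y) \<le> 0 then 1 else 0)"
proof -
  define K where "K = rwidth e + 8"
  define \<rho> :: "nat \<Rightarrow> nat" where "\<rho> = (\<lambda>_. 3)(0 := 1, 1 := 2)"
  define c1 where "c1 = rcode K (RInp (IConst 1)) (\<lambda>_. 0) 1 0"
  define c2 where "c2 = rcode K (RInp (IConst 2)) (\<lambda>_. 0) 2 (length c1)"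
  define l where "l = Suc (length c1 + length c2)"
  define c3 where "c3 = rcode K e \<rho> 4 l"
  define l' where "l' = l + length c3"
  define fin where "fin = [Const 0 0, Arith Sub 4 0 4, Const 0 1, Branch 4 (l' + 5), Const 0 0]"
  define M where "M = \<lparr>prog = c1 @ c2 @ Const 3 0 # c3 @ fin, work = K\<rparr>"
  define p where "p = rcost K (RInp (IConst 1)) + rcost K (RInp (IConst 2)) + [:1:] + rcost K e + [:5:]"
  have at1: "code_at M 0 c1" unfolding code_at_def M_def by auto
  have at2: "code_at M (length c1) c2" unfolding code_at_def M_def by auto
  have at3: "code_at M (length c1 + length c2) (Const 3 0 # c3 @ fin)"
    unfolding code_at_def M_def by (intro exI[of _ "c1 @ c2"] exI[of _ "[]"]) simp
  have at4: "code_at M l (c3 @ fin)" using code_at_Cons[OF at3] by (simp add: l_def)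
  have at5: "code_at M l' fin" using code_at_append(2)[OF at4] by (simp add: l'_def)
  have len: "length (prog M) = l' + 5" by (simp add: M_def l'_def l_def fin_def)
  show thesis
  proof (rule that[of M p])
    fix y d n
    assume d: "padded y 1 = real d" and n: "padded y 2 = real n"
      and le: "d \<le> length y" "n \<le> length y"
    let ?L = "length y"
    let ?s0 = "init_config M y"
    have m0: "mem ?s0 0 = real ?L" "mem ?s0 (Suc K + i) = padded y i" "pc ?s0 = 0" for i
      by (simp_all add: init_config_def M_def padded_def)
    have "\<exists>s'. reaches M (poly (rcost K (RInp (IConst 1))) ?L) ?s0 s' \<and>
        pc s' = pc ?s0 + length (rcode K (RInp (IConst 1)) (\<lambda>_. 0) 1 (pc ?s0)) \<and>
        mem s' 1 = rval (RInp (IConst 1)) (\<lambda>_. ?L) (padded y) \<and>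
        frame 1 (rwidth (RInp (IConst 1))) ?s0 s'"
      by (rule rcode_correct) (use at1 m0 in \<open>simp_all add: c1_def K_def\<close>)
    then obtain s1 where s1: "reaches M (poly (rcost K (RInp (IConst 1))) ?L) ?s0 s1"
        "pc s1 = length c1" "mem s1 1 = real d" "frame 1 3 ?s0 s1"
      using m0 d by (auto simp: c1_def numeral_3_eq_3)
    have m1: "mem s1 0 = real ?L" "mem s1 (Suc K + i) = padded y i" for i
      using frameD[OF s1(4)] m0 by (simp_all add: K_def)
    have "\<exists>s'. reaches M (poly (rcost K (RInp (IConst 2))) ?L) s1 s' \<and>
        pc s' = pc s1 + length (rcode K (RInp (IConst 2)) (\<lambda>_. 0) 2 (pc s1)) \<and>
        mem s' 2 = rval (RInp (IConst 2)) (\<lambda>_. ?L) (padded y) \<and>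
        frame 2 (rwidth (RInp (IConst 2))) s1 s'"
      by (rule rcode_correct) (use at2 m1 s1 in \<open>simp_all add: c2_def K_def\<close>)
    then obtain s2 where s2: "reaches M (poly (rcost K (RInp (IConst 2))) ?L) s1 s2"
        "pc s2 = length c1 + length c2" "mem s2 2 = real n" "frame 2 3 s1 s2"
      using n s1(2) by (auto simp: c2_def numeral_3_eq_3)
    let ?s3 = "exec (Const 3 0) s2"
    have s3: "reaches M 1 s2 ?s3" "pc ?s3 = l"
      using reaches_instr[of M s2 "Const 3 0" "c3 @ fin"] at3 s2 by (simp_all add: l_def)
    have m3: "mem ?s3 1 = real d" "mem ?s3 2 = real n" "mem ?s3 3 = 0"
        "mem ?s3 (Suc K + i) = padded y i" for i
      using frameD[OF s2(4)] s1 s2 m1 by (simp_all add: K_def)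
    have "\<exists>s'. reaches M (poly (rcost K e) ?L) ?s3 s' \<and>
        pc s' = pc ?s3 + length (rcode K e \<rho> 4 (pc ?s3)) \<and>
        mem s' 4 = rval e (header d n) (padded y) \<and> frame 4 (rwidth e) ?s3 s'"
    proof (rule rcode_correct)
      show "code_at M (pc ?s3) (rcode K e \<rho> 4 (pc ?s3))"
        using code_at_append(1)[OF at4] s3(2) by (simp add: c3_def)
      show "\<rho> v < 4" for v by (simp add: \<rho>_def)
      show "mem ?s3 (\<rho> v) = real (header d n v)" for v
        using m3 by (auto simp: \<rho>_def header_def)
      show "header d n v \<le> ?L" for v using le by (simp add: header_def)
      show "4 + rwidth e \<le> Suc K" by (simp add: K_def)
      show "mem ?s3 (Suc K + i) = padded y i" for i by (rule m3)
    qed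
    then obtain s4 where s4: "reaches M (poly (rcost K e) ?L) ?s3 s4" "pc s4 = l'"
        "mem s4 4 = rval e (header d n) (padded y)"
      using s3(2) by (auto simp: c3_def l'_def)
    let ?v = "mem s4 4"
    let ?s5 = "s4\<lparr>mem := (mem s4)(4 := - ?v, 0 := if ?v \<le> 0 then 1 else 0), pc := l' + 5\<rparr>"
    have "reaches M 5 s4 ?s5"
    proof (cases "?v \<le> 0")
      case True
      have "reaches M (Suc (Suc (Suc (Suc 0)))) s4 ?s5"
        apply (rule reaches_Cons[of _ _ "Const 0 0"])
        using at5 s4 apply (simp add: fin_def)
        apply (rule reaches_Cons[of _ _ "Arith Sub 4 0 4"])
        using code_at_Cons[OF at5[unfolded fin_def]] s4 apply simp
        apply (rule reaches_Cons[of _ _ "Const 0 1"])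
        using code_at_Cons[OF code_at_Cons[OF at5[unfolded fin_def]]] s4 apply simp
        apply (rule reaches_Cons[of _ _ "Branch 4 (l' + 5)"])
        using code_at_Cons[OF code_at_Cons[OF code_at_Cons[OF at5[unfolded fin_def]]]] s4 apply simp
        using True by (simp add: reaches_refl fun_upd_twist)
      then show ?thesis by (rule reaches_mono) simp
    next
      case False
      have "reaches M (Suc (Suc (Suc (Suc (Suc 0))))) s4 ?s5"
        apply (rule reaches_Cons[of _ _ "Const 0 0"])
        using at5 s4 apply (simp add: fin_def)
        apply (rule reaches_Cons[of _ _ "Arith Sub 4 0 4"])
        using code_at_Cons[OF at5[unfolded fin_def]] s4 apply simp
        apply (rule reaches_Cons[of _ _ "Const 0 1"])
        using code_at_Cons[OF code_at_Cons[OF at5[unfolded fin_def]]] s4 apply simp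
        apply (rule reaches_Cons[of _ _ "Branch 4 (l' + 5)"])
        using code_at_Cons[OF code_at_Cons[OF code_at_Cons[OF at5[unfolded fin_def]]]] s4 apply simp
        apply (rule reaches_Cons[of _ _ "Const 0 0"])
        using code_at_Cons[OF code_at_Cons[OF code_at_Cons[OF code_at_Cons[OF at5[unfolded fin_def]]]]]
          s4 False apply simp
        using False s4 by (auto simp: reaches_def fun_upd_twist intro!: config.equality)
      then show ?thesis by (simp add: numeral_eq_Suc)
    qed
    note r = reaches_trans[OF reaches_trans[OF reaches_trans[OF reaches_trans[OF
              s1(1) s2(1)] s3(1)] s4(1)] this]
    have "reaches M (poly p ?L) ?s0 ?s5"
      by (rule reaches_mono[OF r]) (simp add: p_def)
    moreover have "halted M ?s5" by (simp add: halted_def len)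
    ultimately have "(step M ^^ poly p ?L) ?s0 = ?s5" by (rule reaches_halted)
    then show "outputs_within M y (poly p ?L) (if rval e (header d n) (padded y) \<le> 0 then 1 else 0)"
      using \<open>halted M ?s5\<close> s4(3) by (simp add: outputs_within_def Let_def)
  qed
qed

lemma pair_word_inject: "pair_word u w = pair_word u' w' \<longleftrightarrow> u = u' \<and> w = w'"
  by (auto simp: pair_word_def)

text \<open>
  The range of the sums in \<open>e\<close> is controlled by \<open>d\<close> and \<open>n\<close> alone, and these belong to the
  instance. The verifier is therefore polynomial on all pairs, including those with a useless
  certificate.
\<close>

lemma NP_R_rexpI:
  fixes q :: "nat poly" and e :: rexp
  assumes "A \<subseteq> B"
    and hdr: "\<And>u. u \<in> B \<Longrightarrow> \<exists>d n xs. u = real d # real n # xs \<and> d \<le> length u \<and> n \<le> length u"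
    and cert: "\<And>u d n xs. u \<in> B \<Longrightarrow> u = real d # real n # xs \<Longrightarrow>
       u \<in> A \<longleftrightarrow> (\<exists>w. length w \<le> poly q (length u) \<and> rval e (header d n) (padded (pair_word u w)) \<le> 0)"
  shows "(B, A) \<in> NP_R"
proof -
  define ok where "ok u w \<longleftrightarrow> (\<exists>d n xs. u = real d # real n # xs \<and>
      rval e (header d n) (padded (pair_word u w)) \<le> 0)" for u w
  have ok: "ok u w \<longleftrightarrow> rval e (header d n) (padded (pair_word u w)) \<le> 0"
    if "u = real d # real n # xs" for u w d n xs
    using that by (auto simp: ok_def)
  let ?B = "{pair_word u w | u w. u \<in> B}" and ?V = "{pair_word u w | u w. u \<in> B \<and> ok u w}"
  obtain M p where M: "\<And>y d n. padded y 1 = real d \<Longrightarrow> padded y 2 = real n \<Longrightarrow> d \<le> length y \<Longrightarrow>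
       n \<le> length y \<Longrightarrow>
       outputs_within M y (poly p (length y)) (if rval e (header d n) (padded y) \<le> 0 then 1 else 0)"
    using rexp_decidable[of e] by metis
  have V: "pair_word u w \<in> ?V \<longleftrightarrow> u \<in> B \<and> ok u w" for u w
    by (auto simp: pair_word_inject)
  have "outputs_within M y (poly p (length y)) (if y \<in> ?V then 1 else 0)" if y_in: "y \<in> ?B" for y
  proof -
    obtain u w where y: "y = pair_word u w" "u \<in> B" using y_in by blast
    obtain d n xs where u: "u = real d # real n # xs" "d \<le> length u" "n \<le> length u"
      using hdr[OF y(2)] by blast
    have "padded y 1 = real d" "padded y 2 = real n" "length u \<le> length y"
      using y u by (simp_all add: padded_def pair_word_def)
    then have "outputs_within M y (poly p (length y))
        (if rval e (header d n) (padded y) \<le> 0 then 1 else 0)"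
      using u by (intro M) auto
    then show ?thesis using V[of u w] ok[OF u(1)] y by simp
  qed
  then have "(?B, ?V) \<in> P_R" unfolding P_R_def by blast
  moreover have "u \<in> A \<longleftrightarrow> (\<exists>w. length w \<le> poly q (length u) \<and> pair_word u w \<in> ?V)" if "u \<in> B" for u
    using hdr[OF that] cert[OF that] ok that unfolding V by blast
  ultimately show ?thesis using \<open>A \<subseteq> B\<close> unfolding NP_R_def by blast
qed

section \<open>Separation of an open convex cone from a subspace\<close>

text \<open>
  Matrices of all sizes are represented as functions
  \<open>nat \<Rightarrow> nat \<Rightarrow> real\<close>. Their pointwise vector space structure makes
  subspaces and linear functionals available for a size that is a variable.
\<close>

instantiation "fun" :: (type, real_vector) real_vector
begin

definition scaleR_fun :: "real \<Rightarrow> ('a \<Rightarrow> 'b) \<Rightarrow> 'a \<Rightarrow> 'b" where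
  "scaleR_fun r f = (\<lambda>x. r *\<^sub>R f x)"

instance
  by standard (auto simp: scaleR_fun_def fun_eq_iff algebra_simps)

end

lemma scaleR_fun_apply [simp]: "(r *\<^sub>R f) x = r *\<^sub>R f x"
  by (simp add: scaleR_fun_def)

lemma maximal_subspace_avoiding:
  fixes C M :: "'a::real_vector set"
  assumes "subspace M" "M \<inter> C = {}"
  obtains N where "subspace N" "M \<subseteq> N" "N \<inter> C = {}"
    "\<And>N'. subspace N' \<Longrightarrow> N \<subseteq> N' \<Longrightarrow> N' \<inter> C = {} \<Longrightarrow> N' = N"
proof -
  let ?A = "{N. subspace N \<and> M \<subseteq> N \<and> N \<inter> C = {}}"
  have "\<exists>N\<in>?A. \<forall>X\<in>?A. N \<subseteq> X \<longrightarrow> X = N"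
  proof (rule subset_Zorn_nonempty)
    show "?A \<noteq> {}" using assms by blast
    fix \<C> assume "\<C> \<noteq> {}" and chain: "subset.chain ?A \<C>"
    have sub: "\<And>X. X \<in> \<C> \<Longrightarrow> subspace X \<and> M \<subseteq> X \<and> X \<inter> C = {}"
      using chain by (auto simp: subset.chain_def)
    have lin: "\<And>X Y. X \<in> \<C> \<Longrightarrow> Y \<in> \<C> \<Longrightarrow> X \<subseteq> Y \<or> Y \<subseteq> X"
      using chain unfolding subset.chain_def by blast
    have "subspace (\<Union>\<C>)"
      unfolding subspace_def
    proof (intro conjI ballI allI)
      show "0 \<in> \<Union>\<C>" using \<open>\<C> \<noteq> {}\<close> sub by (auto simp: subspace_0)
      show "x + y \<in> \<Union>\<C>" if "x \<in> \<Union>\<C>" "y \<in> \<Union>\<C>" for x y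
      proof -
        obtain X Y where "X \<in> \<C>" "x \<in> X" "Y \<in> \<C>" "y \<in> Y" using \<open>x \<in> \<Union>\<C>\<close> \<open>y \<in> \<Union>\<C>\<close> by blast
        then obtain Z where "Z \<in> \<C>" "x \<in> Z" "y \<in> Z" using lin by blast
        then show ?thesis using sub by (blast intro: subspace_add)
      qed
      show "r *\<^sub>R x \<in> \<Union>\<C>" if "x \<in> \<Union>\<C>" for r x
        using that sub by (blast intro: subspace_scale)
    qed
    then show "\<Union>\<C> \<in> ?A" using sub \<open>\<C> \<noteq> {}\<close> by blast
  qed
  then obtain N where "N \<in> ?A" "\<forall>X\<in>?A. N \<subseteq> X \<longrightarrow> X = N" by blast
  then show thesis by (intro that[of N]) auto
qed

text \<open>
  A purely algebraic form of the Hahn--Banach theorem, with openness required along lines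
  only. The point is that a subspace \<open>N\<close> that is maximal among those avoiding \<open>C\<close> is a
  hyperplane with complement spanned by \<open>c\<close>. Otherwise some \<open>v\<close> has \<open>v - t c \<notin> N\<close> for all \<open>t\<close>,
  and by maximality each \<open>v - t c\<close> or its negative lies in \<open>C\<close> modulo \<open>N\<close>. This splits the
  real line into two open half-lines which are nonempty and, as \<open>C\<close> is convex and misses \<open>N\<close>,
  disjoint. The functional is the coordinate along \<open>c\<close>.
\<close>

lemma open_cone_separation:
  fixes C M :: "'a::real_vector set"
  assumes "subspace M" "M \<inter> C = {}" and c: "c \<in> C"
    and add: "\<And>x y. x \<in> C \<Longrightarrow> y \<in> C \<Longrightarrow> x + y \<in> C"
    and scale: "\<And>x r. x \<in> C \<Longrightarrow> 0 < r \<Longrightarrow> r *\<^sub>R x \<in> C"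
    and op: "\<And>x z. x \<in> C \<Longrightarrow> \<exists>\<epsilon>>0. x + \<epsilon> *\<^sub>R z \<in> C"
  shows "\<exists>f :: 'a \<Rightarrow> real. linear f \<and> (\<forall>x\<in>M. f x = 0) \<and> (\<forall>x\<in>C. 0 < f x)"
proof -
  obtain N where N: "subspace N" "M \<subseteq> N" "N \<inter> C = {}"
    and max: "\<And>N'. subspace N' \<Longrightarrow> N \<subseteq> N' \<Longrightarrow> N' \<inter> C = {} \<Longrightarrow> N' = N"
    using maximal_subspace_avoiding[OF assms(1,2)] by blast
  have "\<exists>t. v - t *\<^sub>R c \<in> N" for v
  proof (rule ccontr)
    assume neg: "\<nexists>t. v - t *\<^sub>R c \<in> N"
    define A where "A = {t. \<exists>m\<in>N. (v - t *\<^sub>R c) + m \<in> C}"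
    define B where "B = {t. \<exists>m\<in>N. - (v - t *\<^sub>R c) + m \<in> C}"
    \<comment> \<open>By maximality, the span of \<open>N\<close> and \<open>v - t c\<close> meets \<open>C\<close>, and the sign of the
      coefficient decides between \<open>A\<close> and \<open>B\<close>.\<close>
    have cover: "t \<in> A \<or> t \<in> B" for t
    proof -
      let ?w = "v - t *\<^sub>R c"
      let ?N = "span (insert ?w N)"
      have "?w \<in> ?N" "?w \<notin> N" using neg by (auto intro: span_base)
      then have "?N \<inter> C \<noteq> {}" using max[of ?N] span_superset[of "insert ?w N"] by auto
      moreover have sN: "span N = N" using N(1) by simp
      ultimately obtain x k where x: "x \<in> C" "x - k *\<^sub>R ?w \<in> N"
        using span_breakdown_eq[of _ ?w N, unfolded sN] by auto
      then have "k \<noteq> 0" using N(3) by auto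
      then consider "k > 0" | "k < 0" by linarith
      then show ?thesis
      proof cases
        case 1
        have "(1/k) *\<^sub>R x = ?w + (1/k) *\<^sub>R (x - k *\<^sub>R ?w)" using 1 by (simp add: scaleR_diff_right)
        moreover have "(1/k) *\<^sub>R x \<in> C" using 1 x scale by simp
        moreover have "(1/k) *\<^sub>R (x - k *\<^sub>R ?w) \<in> N" using x by (intro subspace_scale[OF N(1)])
        ultimately show ?thesis unfolding A_def mem_Collect_eq by metis
      next
        case 2
        have "(1/(-k)) *\<^sub>R x = - ?w + (1/(-k)) *\<^sub>R (x - k *\<^sub>R ?w)"
          using 2 by (simp add: scaleR_diff_right)
        moreover have "(1/(-k)) *\<^sub>R x \<in> C" using 2 x scale by (intro scale) auto
        moreover have "(1/(-k)) *\<^sub>R (x - k *\<^sub>R ?w) \<in> N" using x by (intro subspace_scale[OF N(1)])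
        ultimately show ?thesis unfolding B_def mem_Collect_eq by metis
      qed
    qed
    have up: "t' \<in> B" if tB: "t \<in> B" and tt': "t \<le> t'" for t t'
    proof (cases "t = t'")
      case False
      obtain m where m: "m \<in> N" "- (v - t *\<^sub>R c) + m \<in> C" using tB unfolding B_def by blast
      have "(- (v - t *\<^sub>R c) + m) + (t' - t) *\<^sub>R c \<in> C" 
        by (rule add[OF m(2) scale[OF c]]) (use tt' False in simp)
      then have "- (v - t' *\<^sub>R c) + m \<in> C" by (simp add: algebra_simps)
      then show ?thesis using m by (auto simp: B_def)
    qed (use tB in simp)
    have disj: False if tA: "t \<in> A" and tB: "t \<in> B" for t
    proof -
      obtain m m' where "m \<in> N" "(v - t *\<^sub>R c) + m \<in> C" "m' \<in> N" "- (v - t *\<^sub>R c) + m' \<in> C"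
        using tA tB unfolding A_def B_def by blast
      then have "m + m' \<in> C" "m + m' \<in> N"
        using add[of "(v - t *\<^sub>R c) + m" "- (v - t *\<^sub>R c) + m'"] subspace_add[OF N(1)] by (auto simp: algebra_simps)
      then show False using N(3) by blast
    qed
    have below: "t < b" if "t \<in> A" "b \<in> B" for t b
      using up[of b t] disj[of t] that by force
    obtain \<epsilon> where \<epsilon>: "\<epsilon> > 0" "c + \<epsilon> *\<^sub>R v \<in> C" using op[OF c] by blast
    have "(1/\<epsilon>) *\<^sub>R (c + \<epsilon> *\<^sub>R v) \<in> C" using \<epsilon> by (intro scale) auto
    then have "- (1/\<epsilon>) \<in> A" using \<epsilon>(1) subspace_0[OF N(1)]
      unfolding A_def by (auto intro!: bexI[of _ 0] simp: algebra_simps)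
    then have ne: "A \<noteq> {}" by blast
    obtain \<epsilon>' where \<epsilon>': "\<epsilon>' > 0" "c + \<epsilon>' *\<^sub>R (- v) \<in> C" using op[OF c] by blast
    have "(1/\<epsilon>') *\<^sub>R (c + \<epsilon>' *\<^sub>R (- v)) \<in> C" using \<epsilon>' by (intro scale) auto
    then have "1/\<epsilon>' \<in> B" using \<epsilon>'(1) subspace_0[OF N(1)]
      unfolding B_def by (auto intro!: bexI[of _ 0] simp: algebra_simps)
    then have bdd: "bdd_above A" using below by (meson bdd_aboveI less_imp_le)
    define s where "s = Sup A"
    \<comment> \<open>Both half-lines are open, so neither contains the point \<open>s\<close> where they meet.\<close>
    from cover[of s] show False
    proof
      assume "s \<in> A"
      then obtain m where m: "m \<in> N" "(v - s *\<^sub>R c) + m \<in> C" by (auto simp: A_def)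
      obtain \<delta> where \<delta>: "\<delta> > 0" "((v - s *\<^sub>R c) + m) + \<delta> *\<^sub>R (- c) \<in> C" using op[OF m(2)] by blast
      then have "(v - (s + \<delta>) *\<^sub>R c) + m \<in> C" by (simp add: algebra_simps)
      then have "s + \<delta> \<in> A" using m(1) by (auto simp: A_def)
      then show False using cSup_upper[OF _ bdd] \<delta>(1) by (force simp: s_def)
    next
      assume "s \<in> B"
      then obtain m where m: "m \<in> N" "- (v - s *\<^sub>R c) + m \<in> C" by (auto simp: B_def)
      obtain \<delta> where \<delta>: "\<delta> > 0" "(- (v - s *\<^sub>R c) + m) + \<delta> *\<^sub>R (- c) \<in> C" using op[OF m(2)] by blast
      then have "- (v - (s - \<delta>) *\<^sub>R c) + m \<in> C" by (simp add: algebra_simps)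
      then have "s - \<delta> \<in> B" using m(1) by (auto simp: B_def)
      then have "Sup A \<le> s - \<delta>" using below ne by (intro cSup_least) (auto intro: less_imp_le)
      then show False using \<delta>(1) by (simp add: s_def)
    qed
  qed
  then obtain f where f: "\<And>v. v - f v *\<^sub>R c \<in> N" by metis
  have uniq: "f v = t" if t: "v - t *\<^sub>R c \<in> N" for v t
  proof (rule ccontr)
    assume "f v \<noteq> t"
    have "(v - t *\<^sub>R c) - (v - f v *\<^sub>R c) \<in> N" by (rule subspace_diff[OF N(1) t f])
    then have "(f v - t) *\<^sub>R c \<in> N" by (simp add: algebra_simps)
    then have "(1/(f v - t)) *\<^sub>R ((f v - t) *\<^sub>R c) \<in> N" by (rule subspace_scale[OF N(1)])
    then show False using \<open>f v \<noteq> t\<close> c N(3) by auto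
  qed
  show ?thesis
  proof (intro exI[of _ f] conjI ballI)
    show "linear f"
    proof (rule linearI)
      show "f (x + y) = f x + f y" for x y
        using subspace_add[OF N(1) f[of x] f[of y]] by (intro uniq) (simp add: algebra_simps)
      show "f (r *\<^sub>R x) = r *\<^sub>R f x" for r x
        using subspace_scale[OF N(1) f[of x], of r] by (intro uniq) (simp add: algebra_simps)
    qed
    show "f x = 0" if "x \<in> M" for x using that N(2) by (intro uniq) auto
    show "0 < f x" if x: "x \<in> C" for x
    proof (rule ccontr)
      assume "\<not> 0 < f x"
      then have "x - f x *\<^sub>R c \<in> C"
        using add[OF x scale[OF c, of "- f x"]] x by (cases "f x = 0") auto
      then show False using f[of x] N(3) by blast
    qed
  qed
qed

text \<open>
  By induction on the family: a functional \<open>h k0\<close> that does not vanish on the common kernel of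
  the others takes a nonzero value at some \<open>w\<close> in it, and subtracting the multiple of \<open>h k0\<close>
  that matches \<open>g\<close> at \<open>w\<close> leaves a functional that vanishes on the larger kernel.
\<close>

lemma linear_combination_if_common_kernel:
  fixes h :: "'k \<Rightarrow> 'a::real_vector \<Rightarrow> real" and g :: "'a \<Rightarrow> real"
  assumes "finite K" "\<And>k. k \<in> K \<Longrightarrow> linear (h k)"
  shows "linear g \<Longrightarrow> (\<And>x. (\<And>k. k \<in> K \<Longrightarrow> h k x = 0) \<Longrightarrow> g x = 0) \<Longrightarrow>
         \<exists>c. \<forall>x. g x = (\<Sum>k\<in>K. c k * h k x)"
  using assms
proof (induction K arbitrary: g rule: finite_induct)
  case empty
  then show ?case by simp
next
  case (insert k0 K)
  show ?case
  proof (cases "\<forall>x. (\<forall>k\<in>K. h k x = 0) \<longrightarrow> h k0 x = 0")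
    case True
    then have "\<exists>c. \<forall>x. g x = (\<Sum>k\<in>K. c k * h k x)"
      using insert.prems by (intro insert.IH) auto
    then obtain c where "\<forall>x. g x = (\<Sum>k\<in>K. c k * h k x)" by blast
    moreover have "(\<Sum>k\<in>insert k0 K. (c(k0 := 0)) k * h k x) = (\<Sum>k\<in>K. c k * h k x)" for x
      using insert.hyps by (auto intro!: sum.cong)
    ultimately show ?thesis by metis
  next
    case False
    then obtain w where w: "\<forall>k\<in>K. h k w = 0" "h k0 w \<noteq> 0" by blast
    have l0: "linear (h k0)" and lK: "\<And>k. k \<in> K \<Longrightarrow> linear (h k)" using insert.prems by auto
    define \<alpha> where "\<alpha> = g w / h k0 w"
    \<comment> \<open>Moving \<open>x\<close> along \<open>w\<close> reaches the kernel of all the functionals.\<close>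
    have "\<exists>c. \<forall>x. g x - \<alpha> * h k0 x = (\<Sum>k\<in>K. c k * h k x)"
    proof (rule insert.IH)
      show "linear (\<lambda>x. g x - \<alpha> * h k0 x)"
        using linear_compose_sub[OF insert.prems(1) linear_compose_scale_right[OF l0, of \<alpha>]]
        by simp
      fix x assume x: "\<And>k. k \<in> K \<Longrightarrow> h k x = 0"
      let ?r = "h k0 x / h k0 w"
      let ?x = "x - ?r *\<^sub>R w"
      have "g ?x = 0"
      proof (rule insert.prems(2))
        fix k assume "k \<in> insert k0 K"
        then show "h k ?x = 0"
          using x w l0 lK by (auto simp: linear_diff linear_scale)
      qed
      then show "g x - \<alpha> * h k0 x = 0"
        using insert.prems(1) by (simp add: linear_diff linear_scale \<alpha>_def)
    qed (use lK in auto)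
    then obtain c where c: "\<forall>x. g x - \<alpha> * h k0 x = (\<Sum>k\<in>K. c k * h k x)" by blast
    have "(\<Sum>k\<in>insert k0 K. (c(k0 := \<alpha>)) k * h k x) = \<alpha> * h k0 x + (\<Sum>k\<in>K. c k * h k x)" for x
      using insert.hyps by (auto intro!: sum.cong)
    then have "\<forall>x. g x = (\<Sum>k\<in>insert k0 K. (c(k0 := \<alpha>)) k * h k x)" using c by (simp add: algebra_simps)
    then show ?thesis by blast
  qed
qed

section \<open>Positive semidefinite matrices\<close>

type_synonym matrix = "nat \<Rightarrow> nat \<Rightarrow> real"

definition bil :: "nat \<Rightarrow> matrix \<Rightarrow> (nat \<Rightarrow> real) \<Rightarrow> (nat \<Rightarrow> real) \<Rightarrow> real" where
  "bil d X u v = (\<Sum>a<d. u a * (\<Sum>b<d. X a b * v b))"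

definition symm :: "nat \<Rightarrow> matrix \<Rightarrow> bool" where
  "symm d X \<longleftrightarrow> (\<forall>a<d. \<forall>b<d. X a b = X b a)"

definition psd :: "nat \<Rightarrow> matrix \<Rightarrow> bool" where
  "psd d X \<longleftrightarrow> symm d X \<and> (\<forall>v. 0 \<le> bil d X v v)"

definition mmul :: "nat \<Rightarrow> matrix \<Rightarrow> matrix \<Rightarrow> matrix" where
  "mmul d X Y a b = (\<Sum>c<d. X a c * Y c b)"

definition frob :: "nat \<Rightarrow> matrix \<Rightarrow> matrix \<Rightarrow> real" where
  "frob d X Y = (\<Sum>a<d. \<Sum>b<d. X a b * Y a b)"

definition gram :: "nat \<Rightarrow> matrix \<Rightarrow> matrix" where
  "gram d P a b = (\<Sum>c<d. P a c * P b c)"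

lemma bil_sum: "bil d X u v = (\<Sum>a<d. \<Sum>b<d. u a * X a b * v b)"
  by (simp add: bil_def sum_distrib_left mult.assoc)

lemma bil_commute: "symm d X \<Longrightarrow> bil d X u v = bil d X v u"
  unfolding bil_sum by (subst sum.swap) (auto intro!: sum.cong simp: symm_def mult_ac)

lemma bil_add_scale:
  assumes "symm d X"
  shows "bil d X (\<lambda>a. u a + t * v a) (\<lambda>a. u a + t * v a)
       = bil d X u u + 2 * t * bil d X v u + t\<^sup>2 * bil d X v v"
proof -
  have "bil d X (\<lambda>a. u a + t * v a) (\<lambda>a. u a + t * v a)
      = bil d X u u + t * bil d X u v + t * bil d X v u + t\<^sup>2 * bil d X v v"
    by (simp add: bil_sum sum_distrib_left algebra_simps power2_eq_square flip: sum.distrib)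
  then show ?thesis using bil_commute[OF assms, of u v] by simp
qed

lemma bil_unit: "a < d \<Longrightarrow> bil d X (\<lambda>i. if i = a then 1 else 0) v = (\<Sum>b<d. X a b * v b)"
  by (simp add: bil_def if_distrib[of "\<lambda>x. x * _"] cong: if_cong)

text \<open>
  The form \<open>bil d X\<close> at \<open>v + t e\<^sub>a\<close> is a polynomial in \<open>t\<close> without constant term and
  nonnegative everywhere, so its linear coefficient is zero as well.
\<close>

lemma psd_kernel:
  assumes "psd d X" "bil d X v v = 0" "a < d"
  shows "(\<Sum>b<d. X a b * v b) = 0"
proof -
  let ?e = "\<lambda>i. if i = a then 1 else 0 :: real"
  define w where "w = bil d X ?e v"
  define x where "x = bil d X ?e ?e"
  have x: "0 \<le> x" using assms by (simp add: psd_def x_def)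
  define t where "t = - w / (x + 1)"
  have "0 \<le> bil d X (\<lambda>a. v a + t * ?e a) (\<lambda>a. v a + t * ?e a)"
    using assms by (simp add: psd_def)
  then have "0 \<le> 2 * t * w + t\<^sup>2 * x"
    using assms by (subst (asm) bil_add_scale) (auto simp: psd_def w_def x_def)
  also have "w = - t * (x + 1)" using x by (simp add: t_def)
  also have "2 * t * (- t * (x + 1)) + t\<^sup>2 * x = - (t\<^sup>2 * (x + 2))"
    by (simp add: power2_eq_square algebra_simps)
  finally have "t\<^sup>2 * (x + 2) \<le> 0" by simp
  then have "t = 0" using x by (auto simp: mult_le_0_iff)
  then have "w = 0" using x by (simp add: t_def)
  then show ?thesis using bil_unit[OF assms(3)] by (simp add: w_def)
qed

lemma bil_gram: "bil d (gram d P) v v = (\<Sum>c<d. (\<Sum>a<d. P a c * v a)\<^sup>2)"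
proof -
  have "bil d (gram d P) v v = (\<Sum>a<d. \<Sum>b<d. \<Sum>c<d. (P a c * v a) * (P b c * v b))"
    by (simp add: bil_sum gram_def sum_distrib_left sum_distrib_right mult_ac)
  also have "\<dots> = (\<Sum>a<d. \<Sum>c<d. \<Sum>b<d. (P a c * v a) * (P b c * v b))"
    by (intro sum.cong refl sum.swap)
  also have "\<dots> = (\<Sum>c<d. \<Sum>a<d. \<Sum>b<d. (P a c * v a) * (P b c * v b))" by (rule sum.swap)
  finally show ?thesis by (simp add: power2_eq_square sum_product)
qed

lemma psd_gram: "psd d (gram d P)"
  by (auto simp: psd_def symm_def bil_gram gram_def mult.commute intro: sum_nonneg)

text \<open>
  Cholesky factorisation, by induction on the size: the Schur complement \<open>X'\<close> of the last
  diagonal entry \<open>x\<close> is positive semidefinite, because its value at \<open>v\<close> is the minimum of the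
  form of \<open>X\<close> over all extensions of \<open>v\<close> by one coordinate. If \<open>x = 0\<close>, then the last column
  vanishes, and since division by zero gives zero the same formulas apply.
\<close>

lemma psd_is_gram: "psd d X \<Longrightarrow> \<exists>P. \<forall>a<d. \<forall>b<d. X a b = gram d P a b"
proof (induction d arbitrary: X)
  case 0
  then show ?case by simp
next
  case (Suc d)
  note sym = Suc.prems[unfolded psd_def symm_def, THEN conjunct1, rule_format]
  define x where "x = X d d"
  let ?e = "\<lambda>i. if i = d then 1 else 0 :: real"
  have xe: "bil (Suc d) X ?e ?e = x" by (simp add: bil_def x_def)
  then have x: "0 \<le> x" using Suc.prems by (metis psd_def)
  have col0: "X a d = 0" if "x = 0" "a \<le> d" for a
    using psd_kernel[OF Suc.prems, of ?e a] xe that by simp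
  define X' where "X' a b = X a b - X a d * X b d / x" for a b
  have "psd d X'"
    unfolding psd_def
  proof (intro conjI allI)
    show "symm d X'" unfolding symm_def X'_def using sym by (simp add: mult.commute)
    fix v
    define s where "s = (\<Sum>b<d. X b d * v b)"
    \<comment> \<open>The minimising last coordinate.\<close>
    define v' where "v' = (\<lambda>a. if a = d then - s / x else v a)"
    have vd: "(\<Sum>b<d. f b * v' b) = (\<Sum>b<d. f b * v b)" for f
      by (intro sum.cong) (auto simp: v'_def)
    have "bil (Suc d) X v' v' = (\<Sum>a<d. v' a * ((\<Sum>b<d. X a b * v b) + X a d * v' d))
         + v' d * ((\<Sum>b<d. X d b * v b) + x * v' d)"
      by (simp add: bil_def vd x_def)
    also have "(\<Sum>b<d. X d b * v b) = s"
      unfolding s_def using sym by (intro sum.cong) auto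
    also have "(\<Sum>a<d. v' a * ((\<Sum>b<d. X a b * v b) + X a d * v' d))
        = (\<Sum>a<d. v a * ((\<Sum>b<d. X a b * v b) + X a d * v' d))"
      by (intro sum.cong) (auto simp: v'_def)
    also have "\<dots> = bil d X v v + v' d * s"
      by (simp add: bil_def s_def sum_distrib_left algebra_simps sum.distrib)
    also have "v' d = - s / x" by (simp add: v'_def)
    also have "bil d X v v + - s / x * s + - s / x * (s + x * (- s / x)) = bil d X v v - s * s / x"
      by (cases "x = 0") (simp_all add: field_simps)
    also have "\<dots> = bil d X' v v"
    proof -
      have "s * s / x = (\<Sum>a<d. \<Sum>b<d. v a * (X a d * X b d / x) * v b)"
        by (simp add: s_def sum_product sum_divide_distrib mult_ac)
      then show ?thesis
        by (simp add: bil_sum X'_def algebra_simps sum_subtractf)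
    qed
    finally show "0 \<le> bil d X' v v" using Suc.prems by (metis psd_def)
  qed
  then obtain P where P: "\<forall>a<d. \<forall>b<d. X' a b = gram d P a b" using Suc.IH by blast
  define P' where "P' a c = (if c = d then X a d / sqrt x else if a < d then P a c else 0)" for a c
  have split: "gram (Suc d) P' a b = (if a < d \<and> b < d then gram d P a b else 0) + X a d * X b d / x" for a b
    using x by (auto simp: gram_def P'_def)
  have "X a b = gram (Suc d) P' a b" if "a < Suc d" "b < Suc d" for a b
  proof (cases "a < d \<and> b < d")
    case True
    then have "gram d P a b = X' a b" using P by simp
    then show ?thesis using True by (simp add: split X'_def)
  next
    case False
    then have "a = d \<or> b = d" using that by auto
    then have "X a b = X a d * X b d / x"
      using that sym[of a d] sym[of d b] col0[of a] col0[of b] x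
      by (cases "x = 0") (auto simp: x_def)
    then show ?thesis using False by (simp only: split) auto
  qed
  then show ?case by blast
qed

definition sq_norm :: "nat \<Rightarrow> (nat \<Rightarrow> real) \<Rightarrow> real" where
  "sq_norm d v = (\<Sum>a<d. (v a)\<^sup>2)"

lemma sq_norm_nonneg: "0 \<le> sq_norm d v"
  by (simp add: sq_norm_def sum_nonneg)

lemma bil_lower_bound: "- (\<Sum>a<d. \<Sum>b<d. \<bar>Z a b\<bar>) * sq_norm d v \<le> bil d Z v v"
proof -
  have "- (\<bar>Z a b\<bar> * sq_norm d v) \<le> v a * Z a b * v b" if "a < d" "b < d" for a b
  proof -
    have "(v a)\<^sup>2 \<le> sq_norm d v" "(v b)\<^sup>2 \<le> sq_norm d v"
      unfolding sq_norm_def using that by (auto intro!: member_le_sum)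
    moreover have "2 * \<bar>v a * v b\<bar> \<le> (v a)\<^sup>2 + (v b)\<^sup>2"
      using sum_squares_bound[of "\<bar>v a\<bar>" "\<bar>v b\<bar>"] by (simp add: abs_mult)
    ultimately have "\<bar>v a * v b\<bar> \<le> sq_norm d v" by linarith
    then have "\<bar>Z a b\<bar> * \<bar>v a * v b\<bar> \<le> \<bar>Z a b\<bar> * sq_norm d v" by (intro mult_left_mono) auto
    then have "\<bar>v a * Z a b * v b\<bar> \<le> \<bar>Z a b\<bar> * sq_norm d v" by (simp add: abs_mult mult_ac)
    then show ?thesis by linarith
  qed
  then have "(\<Sum>a<d. \<Sum>b<d. - (\<bar>Z a b\<bar> * sq_norm d v)) \<le> bil d Z v v"
    unfolding bil_sum by (intro sum_mono) auto
  then show ?thesis by (simp add: sum_negf sum_distrib_right)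
qed

text \<open>
  Gram--Schmidt: the orthogonal projection of \<open>v\<close> onto the span of \<open>s 0, \<dots>, s (m - 1)\<close>, in
  coordinates.
\<close>

lemma projection_exists:
  fixes s :: "nat \<Rightarrow> nat \<Rightarrow> real"
  shows "\<exists>c. \<forall>k<m. (\<Sum>a<d. (v a - (\<Sum>j<m. c j * s j a)) * s k a) = 0"
proof (induction m arbitrary: v)
  case 0
  then show ?case by simp
next
  case (Suc m)
  obtain c where c: "\<And>k. k < m \<Longrightarrow> (\<Sum>a<d. (v a - (\<Sum>j<m. c j * s j a)) * s k a) = 0"
    using Suc by blast
  obtain e where e: "\<And>k. k < m \<Longrightarrow> (\<Sum>a<d. (s m a - (\<Sum>j<m. e j * s j a)) * s k a) = 0"
    using Suc by blast
  define v' where "v' a = v a - (\<Sum>j<m. c j * s j a)" for a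
  define s' where "s' a = s m a - (\<Sum>j<m. e j * s j a)" for a
  define N where "N = (\<Sum>a<d. s' a * s' a)"
  define \<alpha> where "\<alpha> = (\<Sum>a<d. v' a * s' a) / N"
  have orth: "(\<Sum>a<d. (v' a - \<alpha> * s' a) * s k a) = 0" if "k < m" for k
    using c[OF that] e[OF that]
    by (simp add: left_diff_distrib sum_subtractf mult.assoc flip: sum_distrib_left v'_def s'_def)
  have "(\<Sum>a<d. (v' a - \<alpha> * s' a) * s' a) = (\<Sum>a<d. v' a * s' a) - \<alpha> * N"
    by (simp add: N_def left_diff_distrib sum_subtractf mult.assoc sum_distrib_left)
  also have "\<dots> = 0"
  proof (cases "N = 0")
    case True
    then have "\<forall>a\<in>{..<d}. s' a * s' a = 0"
      unfolding N_def by (subst (asm) sum_nonneg_eq_0_iff) auto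
    then show ?thesis by (simp add: True)
  qed (simp add: \<alpha>_def)
  finally have orth': "(\<Sum>a<d. (v' a - \<alpha> * s' a) * s' a) = 0" .
  have sm: "s m a = s' a + (\<Sum>j<m. e j * s j a)" for a by (simp add: s'_def)
  have "(\<Sum>a<d. (v' a - \<alpha> * s' a) * s m a)
      = (\<Sum>a<d. (v' a - \<alpha> * s' a) * s' a + (\<Sum>j<m. e j * ((v' a - \<alpha> * s' a) * s j a)))"
    by (intro sum.cong refl, subst sm) (simp add: distrib_left sum_distrib_left mult.left_commute)
  also have "\<dots> = (\<Sum>j<m. e j * (\<Sum>a<d. (v' a - \<alpha> * s' a) * s j a))"
    unfolding sum.distrib orth' by (subst sum.swap) (simp add: sum_distrib_left)
  also have "\<dots> = 0" using orth by simp
  finally have orthm: "(\<Sum>a<d. (v' a - \<alpha> * s' a) * s m a) = 0" .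
  define c' where "c' j = (if j = m then \<alpha> else c j - \<alpha> * e j)" for j
  have "v a - (\<Sum>j<Suc m. c' j * s j a) = v' a - \<alpha> * s' a" for a
  proof -
    have "(\<Sum>j<m. c' j * s j a) = (\<Sum>j<m. (c j - \<alpha> * e j) * s j a)"
      by (intro sum.cong) (auto simp: c'_def)
    then show ?thesis
      by (simp add: v'_def s'_def c'_def algebra_simps sum_subtractf sum_distrib_left)
  qed
  then have "\<forall>k<Suc m. (\<Sum>a<d. (v a - (\<Sum>j<Suc m. c' j * s j a)) * s k a) = 0"
    using orth orthm by (simp add: less_Suc_eq)
  then show ?case by blast
qed

text \<open>
  As \<open>S\<close> is symmetric, every vector is a sum of one in its kernel and one in its range, and
  \<open>X S = 0\<close> says that \<open>X\<close> kills the range.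
\<close>

lemma psd_if_psd_on_kernel:
  assumes X: "symm d X" and S: "symm d S"
    and XS: "\<And>a b. a < d \<Longrightarrow> b < d \<Longrightarrow> mmul d X S a b = 0"
    and kernel: "\<And>v. (\<And>a. a < d \<Longrightarrow> (\<Sum>b<d. S a b * v b) = 0) \<Longrightarrow> 0 \<le> bil d X v v"
  shows "psd d X"
  unfolding psd_def
proof (intro conjI allI X)
  fix v
  obtain c where c: "\<And>k. k < d \<Longrightarrow> (\<Sum>a<d. (v a - (\<Sum>j<d. c j * S a j)) * S a k) = 0"
    using projection_exists[where m = d and d = d and v = v and s = "\<lambda>j a. S a j"] by blast
  define u where "u a = (\<Sum>j<d. c j * S a j)" for a
  define w where "w a = v a - u a" for a
  have "(\<Sum>b<d. S a b * w b) = 0" if "a < d" for a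
  proof -
    have "(\<Sum>b<d. S a b * w b) = (\<Sum>b<d. w b * S b a)"
      using S that by (intro sum.cong) (auto simp: symm_def mult.commute)
    then show ?thesis using c[OF that] by (simp add: w_def u_def)
  qed
  then have w0: "0 \<le> bil d X w w" by (rule kernel)
  have "(\<Sum>b<d. X a b * u b) = (\<Sum>j<d. c j * mmul d X S a j)" for a
    unfolding u_def mmul_def sum_distrib_left by (subst sum.swap) (simp add: mult_ac)
  then have "(\<Sum>b<d. X a b * u b) = 0" if "a < d" for a using XS that by simp
  then have "bil d X y u = 0" for y by (simp add: bil_def)
  moreover have "v = (\<lambda>a. w a + 1 * u a)" by (simp add: w_def)
  ultimately show "0 \<le> bil d X v v"
    using bil_add_scale[OF X, of w 1 u] bil_commute[OF X, of u w] w0 by simp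
qed

text \<open>
  Bessel's inequality for each unit vector \<open>e\<^sub>a\<close>, summed over \<open>a\<close>: the left-hand sides add up
  to \<open>m\<close> and the right-hand sides to \<open>d\<close>.
\<close>

lemma orthogonal_family_le:
  fixes p :: "nat \<Rightarrow> nat \<Rightarrow> real"
  assumes nz: "\<And>i. i < m \<Longrightarrow> \<exists>a<d. p i a \<noteq> 0"
    and orth: "\<And>i k. i < m \<Longrightarrow> k < i \<Longrightarrow> (\<Sum>a<d. p k a * p i a) = 0"
  shows "m \<le> d"
proof -
  define N where "N i = (\<Sum>a<d. p i a * p i a)" for i
  have N: "0 < N i" if "i < m" for i
  proof -
    obtain a where "a < d" "p i a \<noteq> 0" using nz[OF \<open>i < m\<close>] by blast
    then show ?thesis unfolding N_def
      by (intro sum_pos2[of _ a]) (auto simp: zero_less_mult_iff)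
  qed
  have o: "(\<Sum>b<d. p i b * p k b) = (if i = k then N i else 0)" if "i < m" "k < m" for i k
    using orth[of k i] orth[of i k] that by (cases i k rule: linorder_cases) (auto simp: N_def mult.commute)
  have le1: "(\<Sum>i<m. p i a * p i a / N i) \<le> 1" if "a < d" for a
  proof -
    define q where "q b = (\<Sum>i<m. p i a * p i b / N i)" for b
    have "(\<Sum>b<d. q b * q b) = (\<Sum>b<d. \<Sum>i<m. \<Sum>k<m. (p i a / N i) * (p k a / N k) * (p i b * p k b))"
      unfolding q_def sum_product by (simp add: mult_ac)
    also have "\<dots> = (\<Sum>i<m. \<Sum>k<m. \<Sum>b<d. (p i a / N i) * (p k a / N k) * (p i b * p k b))"
      by (subst sum.swap) (intro sum.cong refl sum.swap)
    also have "\<dots> = (\<Sum>i<m. \<Sum>k<m. (p i a / N i) * (p k a / N k) * (if i = k then N i else 0))"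
      by (intro sum.cong refl) (simp only: sum_distrib_left[symmetric] lessThan_iff o)
    also have "\<dots> = (\<Sum>i<m. p i a * p i a / N i)"
      by (intro sum.cong refl) (use N in \<open>force simp: if_distrib[of "\<lambda>x. _ * x"] cong: if_cong\<close>)
    finally have qq: "(\<Sum>b<d. q b * q b) = q a" by (simp add: q_def)
    let ?\<delta> = "\<lambda>b. if b = a then 1 else 0 :: real"
    have "0 \<le> (\<Sum>b<d. (?\<delta> b - q b)\<^sup>2)" by (intro sum_nonneg) auto
    also have "\<dots> = (\<Sum>b<d. ?\<delta> b - 2 * (if b = a then q b else 0) + q b * q b)"
      by (intro sum.cong) (auto simp: power2_eq_square algebra_simps)
    also have "\<dots> = 1 - 2 * q a + q a"
      using that by (simp add: sum.distrib sum_subtractf qq flip: sum_distrib_left)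
    finally show ?thesis by (simp add: q_def)
  qed
  have "real m = (\<Sum>i<m. N i / N i)" using N by (simp add: less_imp_neq[THEN not_sym])
  also have "\<dots> = (\<Sum>i<m. \<Sum>a<d. p i a * p i a / N i)"
    by (simp flip: sum_divide_distrib N_def)
  also have "\<dots> = (\<Sum>a<d. \<Sum>i<m. p i a * p i a / N i)" by (rule sum.swap)
  also have "\<dots> \<le> (\<Sum>a<d. 1)" by (intro sum_mono le1) auto
  finally show ?thesis by simp
qed

section \<open>Certificates of infeasibility by facial reduction\<close>

lemma sum_apply: "(\<Sum>i\<in>I. f i) x = (\<Sum>i\<in>I. f i x)"
  by (induction I rule: infinite_finite_induct) auto

definition pencil :: "nat \<Rightarrow> (nat \<Rightarrow> matrix) \<Rightarrow> (nat \<Rightarrow> real) \<Rightarrow> matrix" where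
  "pencil n A x a b = A 0 a b + (\<Sum>j<n. x j * A (Suc j) a b)"

definition kernel :: "nat \<Rightarrow> matrix \<Rightarrow> (nat \<Rightarrow> real) set" where
  "kernel d S = {v. \<forall>a<d. (\<Sum>b<d. S a b * v b) = 0}"

text \<open>
  The uniform constant \<open>\<delta>\<close> expresses that \<open>X\<close> is positive definite on the kernel of \<open>S\<close> in a
  form that makes openness of the cone a direct estimate.
\<close>

definition interior_cone :: "nat \<Rightarrow> matrix \<Rightarrow> (matrix \<times> real) set" where
  "interior_cone d S =
     {(X, t). 0 < t \<and> (\<exists>\<delta>>0. \<forall>v\<in>kernel d S. \<delta> * sq_norm d v \<le> bil d X v v)}"

lemma bil_linear:
  "bil d (X + Y) u v = bil d X u v + bil d Y u v"
  "bil d (r *\<^sub>R X) u v = r * bil d X u v"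
  by (simp_all add: bil_sum algebra_simps sum.distrib sum_distrib_left)

lemma interior_cone_add:
  assumes "p \<in> interior_cone d S" "q \<in> interior_cone d S"
  shows "p + q \<in> interior_cone d S"
proof -
  obtain X t Y s where pq: "p = (X, t)" "q = (Y, s)" by (metis surj_pair)
  obtain \<delta> \<epsilon> where "0 < \<delta>" "\<forall>v\<in>kernel d S. \<delta> * sq_norm d v \<le> bil d X v v"
    "0 < \<epsilon>" "\<forall>v\<in>kernel d S. \<epsilon> * sq_norm d v \<le> bil d Y v v" "0 < t" "0 < s"
    using assms by (auto simp: interior_cone_def pq)
  then show ?thesis
    by (auto simp: interior_cone_def pq bil_linear distrib_right intro!: exI[of _ "\<delta> + \<epsilon>"] add_mono)
qed

lemma interior_cone_scale:
  assumes "p \<in> interior_cone d S" "0 < r"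
  shows "r *\<^sub>R p \<in> interior_cone d S"
proof -
  obtain X t where p: "p = (X, t)" by (metis surj_pair)
  obtain \<delta> where "0 < \<delta>" "\<forall>v\<in>kernel d S. \<delta> * sq_norm d v \<le> bil d X v v" "0 < t"
    using assms by (auto simp: interior_cone_def p)
  then show ?thesis using assms(2)
    by (auto simp: interior_cone_def p bil_linear mult.assoc intro!: exI[of _ "r * \<delta>"] mult_left_mono)
qed

lemma interior_cone_open:
  assumes "p \<in> interior_cone d S"
  shows "\<exists>\<epsilon>>0. p + \<epsilon> *\<^sub>R q \<in> interior_cone d S"
proof -
  obtain X t Z s where pq: "p = (X, t)" "q = (Z, s)" by (metis surj_pair)
  obtain \<delta> where \<delta>: "0 < \<delta>" "\<forall>v\<in>kernel d S. \<delta> * sq_norm d v \<le> bil d X v v" and t: "0 < t"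
    using assms by (auto simp: interior_cone_def pq)
  define B where "B = (\<Sum>a<d. \<Sum>b<d. \<bar>Z a b\<bar>)"
  have B: "0 \<le> B" by (simp add: B_def sum_nonneg)
  define \<epsilon> where "\<epsilon> = min (\<delta> / (2 * (B + 1))) (t / (2 * (\<bar>s\<bar> + 1)))"
  have \<epsilon>: "0 < \<epsilon>" using \<delta>(1) t B by (simp add: \<epsilon>_def add_nonneg_pos)
  have "\<epsilon> * (B + 1) \<le> \<delta> / (2 * (B + 1)) * (B + 1)"
    using B by (intro mult_right_mono) (auto simp: \<epsilon>_def)
  also have "\<dots> = \<delta> / 2" using B by (simp add: field_simps)
  finally have e1: "\<epsilon> * B \<le> \<delta> / 2" using \<epsilon> by (simp add: distrib_left)
  have "\<epsilon> * (\<bar>s\<bar> + 1) \<le> t / (2 * (\<bar>s\<bar> + 1)) * (\<bar>s\<bar> + 1)"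
    by (intro mult_right_mono) (auto simp: \<epsilon>_def)
  also have "\<dots> = t / 2" by (simp add: field_simps)
  finally have "\<epsilon> * \<bar>s\<bar> < t" using \<epsilon> t by (simp add: distrib_left)
  moreover have "- (\<epsilon> * \<bar>s\<bar>) \<le> \<epsilon> * s" using \<epsilon> by (simp add: abs_if)
  ultimately have "0 < t + \<epsilon> * s" by linarith
  moreover have "\<delta> / 2 * sq_norm d v \<le> bil d (X + \<epsilon> *\<^sub>R Z) v v" if "v \<in> kernel d S" for v
  proof -
    have "- (\<delta> / 2 * sq_norm d v) \<le> \<epsilon> * (- B * sq_norm d v)"
      using mult_right_mono[OF e1 sq_norm_nonneg[of d v]] by (simp add: mult.assoc)
    also have "\<dots> \<le> \<epsilon> * bil d Z v v"
      using bil_lower_bound[where Z = Z and d = d and v = v] \<epsilon> by (intro mult_left_mono) (auto simp: B_def)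
    finally show ?thesis using \<delta>(2) that by (fastforce simp: bil_linear)
  qed
  ultimately show ?thesis using \<epsilon> \<delta>(1)
    by (intro exI[of _ \<epsilon>] conjI) (auto simp: interior_cone_def pq intro!: exI[of _ "\<delta> / 2"])
qed

definition unit_matrix :: "nat \<Rightarrow> nat \<Rightarrow> matrix" where
  "unit_matrix a b = (\<lambda>i j. if i = a \<and> j = b then 1 else 0)"

lemma sum_unit_matrix:
  "(\<Sum>a<d. \<Sum>b<d. X a b *\<^sub>R unit_matrix a b) i j = (if i < d \<and> j < d then X i j else 0)"
proof -
  have "(\<Sum>a<d. \<Sum>b<d. X a b *\<^sub>R unit_matrix a b) i j
      = (\<Sum>a<d. \<Sum>b<d. if a = i then (if b = j then X a b else 0) else 0)"
    by (simp add: sum_apply unit_matrix_def)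
       (intro sum.cong refl, auto)
  also have "\<dots> = (\<Sum>a<d. if a = i then (\<Sum>b<d. if b = j then X a b else 0) else 0)"
    by (intro sum.cong refl) auto
  also have "\<dots> = (if i < d \<and> j < d then X i j else 0)" by (simp add: sum.delta)
  finally show ?thesis .
qed

text \<open>
  The coordinate \<open>t\<close> homogenises the affine problem: a matrix \<open>\<Sum>\<^sub>j x\<^sub>j A\<^sub>j\<close> with \<open>x\<^sub>0 > 0\<close>
  that is positive semidefinite gives a feasible point after division by \<open>x\<^sub>0\<close>. Let a
  functional vanish at all pairs \<open>(\<Sum>\<^sub>j x\<^sub>j A\<^sub>j, x\<^sub>0)\<close> with \<open>(\<Sum>\<^sub>j x\<^sub>j A\<^sub>j) S = 0\<close> and be
  positive on the interior cone. It has the form \<open>(X, t) \<mapsto> Y \<bullet> X + y0 t\<close>. On the whole span of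
  the \<open>A\<^sub>j\<close> it vanishes on the common kernel of the functionals \<open>x \<mapsto> ((\<Sum>\<^sub>j x\<^sub>j A\<^sub>j) S) a b\<close>,
  so it is a combination of these, and the coefficients, negated, are the entries of \<open>R\<close>.
\<close>

lemma facial_step:
  assumes symA: "\<And>j. j \<le> n \<Longrightarrow> symm d (A j)" and S: "symm d S"
    and infeasible: "\<And>x. \<not> psd d (pencil n A x)"
  shows "\<exists>Y R y0. psd d Y \<and> (\<forall>a<d. \<forall>b<d. mmul d S Y a b = 0) \<and>
    0 \<le> y0 \<and> 0 < (\<Sum>a<d. Y a a) + y0 \<and>
    (\<forall>j\<le>n. frob d Y (A j) + (\<Sum>a<d. \<Sum>b<d. R a b * mmul d (A j) S a b)
        = (if j = 0 then - y0 else 0))"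
proof -
  define L :: "(nat \<Rightarrow> real) \<Rightarrow> matrix" where "L x = (\<Sum>j\<le>n. x j *\<^sub>R A j)" for x
  have L_apply: "L x a b = (\<Sum>j\<le>n. x j * A j a b)" for x a b
    by (simp add: L_def sum_apply)
  define \<iota> where "\<iota> x = (L x, x 0)" for x
  have lin_\<iota>: "linear \<iota>"
    by (rule linearI)
       (simp_all add: \<iota>_def L_def scaleR_add_left sum.distrib scaleR_right.sum)
  define h where "h k x = mmul d (L x) S (fst k) (snd k)" for k x
  have lin_h: "linear (h k)" for k
    by (rule linearI)
       (simp_all add: h_def mmul_def L_apply algebra_simps sum.distrib sum_distrib_left sum_distrib_right)
  define K where "K = {..<d} \<times> {..<d}"
  define M where "M = \<iota> ` {x. \<forall>k\<in>K. h k x = 0}"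
  let ?C = "interior_cone d S"
  let ?I = "\<lambda>a b. if a = b then 1 else 0 :: real"
  have bil_I: "bil d ?I v v = sq_norm d v" for v
    by (simp add: bil_def sq_norm_def power2_eq_square if_distrib[of "\<lambda>x. x * _"] cong: if_cong)
  have id: "(?I, 1) \<in> ?C" by (auto simp: interior_cone_def bil_I intro!: exI[of _ 1])
  have sub: "subspace M" unfolding M_def
    by (intro linear_subspace_image lin_\<iota>)
       (auto simp: subspace_def linear_0[OF lin_h] linear_add[OF lin_h] linear_scale[OF lin_h])
  have disj: "M \<inter> ?C = {}"
  proof (rule ccontr)
    assume "M \<inter> ?C \<noteq> {}"
    then obtain x where x: "\<iota> x \<in> ?C" "\<forall>k\<in>K. h k x = 0" unfolding M_def by blast
    then obtain \<delta> where \<delta>: "0 < x 0" "0 < \<delta>" "\<forall>v\<in>kernel d S. \<delta> * sq_norm d v \<le> bil d (L x) v v"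
      by (auto simp: interior_cone_def \<iota>_def)
    have "psd d (L x)"
    proof (rule psd_if_psd_on_kernel[OF _ S])
      show "symm d (L x)" using symA by (auto simp: symm_def L_apply intro!: sum.cong)
      show "mmul d (L x) S a b = 0" if "a < d" "b < d" for a b
        using x(2) that by (simp add: h_def K_def)
      show "0 \<le> bil d (L x) v v" if "\<And>a. a < d \<Longrightarrow> (\<Sum>b<d. S a b * v b) = 0" for v
      proof -
        have "\<delta> * sq_norm d v \<le> bil d (L x) v v" using \<delta>(3) that by (simp add: kernel_def)
        then show ?thesis using \<delta>(2) sq_norm_nonneg[of d v] by (smt (verit) mult_nonneg_nonneg)
      qed
    qed
    moreover have "pencil n A (\<lambda>j. x (Suc j) / x 0) a b = 1 / x 0 * L x a b" for a b
    proof -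
      have "L x a b = x 0 * A 0 a b + (\<Sum>j<n. x (Suc j) * A (Suc j) a b)"
        unfolding L_apply lessThan_Suc_atMost[symmetric] by (rule sum.lessThan_Suc_shift)
      moreover have "(\<Sum>j<n. x (Suc j) / x 0 * A (Suc j) a b) = (\<Sum>j<n. x (Suc j) * A (Suc j) a b) / x 0"
        by (simp add: sum_divide_distrib)
      ultimately show ?thesis using \<delta>(1) by (simp add: pencil_def add_divide_distrib)
    qed
    then have "pencil n A (\<lambda>j. x (Suc j) / x 0) = (1 / x 0) *\<^sub>R L x" by (simp add: fun_eq_iff)
    ultimately have "psd d (pencil n A (\<lambda>j. x (Suc j) / x 0))"
      using \<delta>(1) by (simp add: psd_def bil_linear symm_def)
    then show False using infeasible by blast
  qed
  obtain f :: "matrix \<times> real \<Rightarrow> real" where f: "linear f"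
    "\<And>p. p \<in> M \<Longrightarrow> f p = 0" "\<And>p. p \<in> ?C \<Longrightarrow> 0 < f p"
    using open_cone_separation[OF sub disj id interior_cone_add interior_cone_scale interior_cone_open]
    by blast
  have nonneg: "0 \<le> f (X, t)" if X: "\<And>v. v \<in> kernel d S \<Longrightarrow> 0 \<le> bil d X v v" and t: "0 \<le> t" for X t
  proof (rule ccontr)
    assume neg: "\<not> 0 \<le> f (X, t)"
    define \<epsilon> where "\<epsilon> = - f (X, t) / f (?I, 1)"
    have \<epsilon>: "0 < \<epsilon>" using neg f(3)[OF id] by (simp add: \<epsilon>_def divide_neg_pos)
    \<comment> \<open>The value of \<open>f\<close> at this point of the cone would be zero.\<close>
    have "(X, t) + \<epsilon> *\<^sub>R (?I, 1) \<in> ?C"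
      using X t \<epsilon> by (auto simp: interior_cone_def bil_linear bil_I intro!: exI[of _ \<epsilon>])
    then have "0 < f (X, t) + \<epsilon> * f (?I, 1)"
      using f(3) by (fastforce simp: linear_add[OF f(1)] linear_scale[OF f(1)] simp del: scaleR_Pair add_Pair)
    then show False using f(3)[OF id] by (simp add: \<epsilon>_def)
  qed
  define g where "g X = f (X, 0)" for X
  have "linear (\<lambda>X :: matrix. (X, 0 :: real))" by (rule linearI) simp_all
  from linear_compose[OF this f(1)] have lin_g: "linear g" unfolding g_def o_def .
  \<comment> \<open>A matrix whose form vanishes on the kernel of \<open>S\<close> may be added to the cone with
    either sign. This applies to matrices without entries in the leading block, to
    antisymmetric ones, and to those of the form \<open>s e\<^sub>b\<^sup>T\<close> with \<open>s\<close> a row of \<open>S\<close>; hence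
    the representation by \<open>Y\<close>, the symmetry of \<open>Y\<close> and \<open>S Y = 0\<close>.\<close>
  have null: "g X = 0" if "\<And>v. v \<in> kernel d S \<Longrightarrow> bil d X v v = 0" for X
  proof -
    have "bil d (- X) v v = - bil d X v v" for v by (simp add: bil_sum sum_negf)
    then have "0 \<le> g X" "0 \<le> g (- X)" using that unfolding g_def by (auto intro!: nonneg)
    then show ?thesis using linear_neg[OF lin_g, of X] by simp
  qed
  define Y where "Y a b = g (unit_matrix a b)" for a b
  define y0 where "y0 = f (0, 1)"
  have g: "g X = frob d X Y" for X
  proof -
    let ?X = "\<Sum>a<d. \<Sum>b<d. X a b *\<^sub>R unit_matrix a b"
    have "bil d (X - ?X) v v = 0" for v
      by (simp add: bil_sum sum_unit_matrix fun_diff_def)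
    then have "g (X - ?X) = 0" by (rule null)
    then have "g X = g ?X" by (simp add: linear_diff[OF lin_g])
    also have "\<dots> = frob d X Y"
      by (simp add: linear_sum[OF lin_g] linear_scale[OF lin_g] frob_def Y_def)
    finally show ?thesis .
  qed
  have f_eq: "f (X, t) = frob d X Y + t * y0" for X t
  proof -
    have "(X, t) = (X, 0) + t *\<^sub>R (0, 1)" by simp
    then have "f (X, t) = f (X, 0) + t * f (0, 1)"
      by (simp only: linear_add[OF f(1)] linear_scale[OF f(1)] real_scaleR_def)
    then show ?thesis by (simp add: y0_def g flip: g_def)
  qed
  have symY: "symm d Y"
    unfolding symm_def
  proof (intro allI impI)
    fix a b assume "a < d" "b < d"
    have "bil d (unit_matrix a b - unit_matrix b a) v v = 0" for v
    proof -
      have "bil d (unit_matrix i j) v v = (if i < d \<and> j < d then v i * v j else 0)" for i j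
      proof -
        have "bil d (unit_matrix i j) v v = (\<Sum>a<d. if a = i then v a * (\<Sum>b<d. if b = j then v b else 0) else 0)"
          unfolding bil_def unit_matrix_def by (intro sum.cong refl)
            (simp add: if_distrib[of "\<lambda>x. x * _"] cong: if_cong)
        then show ?thesis by simp
      qed
      moreover have "bil d (X - Z) v v = bil d X v v - bil d Z v v" for X Z
        by (simp add: bil_sum algebra_simps sum_subtractf)
      ultimately show ?thesis by (simp add: mult.commute)
    qed
    then have "g (unit_matrix a b - unit_matrix b a) = 0" by (rule null)
    then show "Y a b = Y b a" by (simp add: linear_diff[OF lin_g] Y_def)
  qed
  have psdY: "psd d Y"
    unfolding psd_def
  proof (intro conjI allI symY)
    fix v
    have "bil d (\<lambda>a b. v a * v b) u u = (\<Sum>a<d. u a * v a)\<^sup>2" for u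
      by (simp add: bil_sum power2_eq_square sum_product mult_ac)
    then have "0 \<le> f ((\<lambda>a b. v a * v b), 0)" by (intro nonneg) auto
    also have "\<dots> = bil d Y v v" by (simp add: f_eq frob_def bil_sum mult_ac)
    finally show "0 \<le> bil d Y v v" .
  qed
  have SY: "mmul d S Y a b = 0" if "a < d" "b < d" for a b
  proof -
    let ?T = "\<lambda>i j. if j = b then S a i else 0"
    have "g ?T = 0"
    proof (rule null)
      fix v assume v: "v \<in> kernel d S"
      have "bil d ?T v v = (\<Sum>i<d. v i * (S a i * v b))"
        unfolding bil_def using that
        by (intro sum.cong refl) (simp add: if_distrib[of "\<lambda>x. x * _"] cong: if_cong)
      also have "\<dots> = (\<Sum>i<d. S a i * v i) * v b"
        by (simp add: sum_distrib_left sum_distrib_right mult_ac)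
      finally show "bil d ?T v v = 0" using v that by (simp add: kernel_def)
    qed
    moreover have "g ?T = mmul d S Y a b"
      using that by (simp add: g frob_def mmul_def if_distrib[of "\<lambda>x. x * _"] cong: if_cong)
    ultimately show ?thesis by simp
  qed
  have "\<exists>c. \<forall>x. f (\<iota> x) = (\<Sum>k\<in>K. c k * h k x)"
  proof (rule linear_combination_if_common_kernel)
    show "linear (\<lambda>x. f (\<iota> x))" using linear_compose[OF lin_\<iota> f(1)] by (simp add: o_def)
    show "f (\<iota> x) = 0" if "\<And>k. k \<in> K \<Longrightarrow> h k x = 0" for x
      using that by (intro f(2)) (auto simp: M_def)
  qed (auto simp: K_def lin_h)
  then obtain c where c: "\<And>x. f (\<iota> x) = (\<Sum>k\<in>K. c k * h k x)" by blast
  show ?thesis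
  proof (rule exI[of _ Y], rule exI[of _ "\<lambda>a b. - c (a, b)"], rule exI[of _ y0],
      intro conjI allI impI)
    show "0 \<le> y0" unfolding y0_def by (rule nonneg) (simp_all add: bil_sum)
    show "0 < (\<Sum>a<d. Y a a) + y0"
      using f(3)[OF id] by (simp add: f_eq frob_def if_distrib[of "\<lambda>x. x * _"] cong: if_cong)
    fix j assume j: "j \<le> n"
    let ?x = "\<lambda>i. if i = j then 1 else 0 :: real"
    have "L ?x a b = A j a b" for a b
      using j by (simp add: L_apply if_distrib[of "\<lambda>x. x * _"] cong: if_cong)
    then have L: "L ?x = A j" by (simp add: fun_eq_iff)
    have "frob d (A j) Y + (if j = 0 then 1 else 0) * y0 = (\<Sum>k\<in>K. c k * h k ?x)"
      using c[of ?x] by (simp add: \<iota>_def L f_eq)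
    also have "\<dots> = (\<Sum>a<d. \<Sum>b<d. c (a, b) * mmul d (A j) S a b)"
      by (simp add: K_def h_def L sum.cartesian_product case_prod_unfold)
    finally show "frob d Y (A j) + (\<Sum>a<d. \<Sum>b<d. - c (a, b) * mmul d (A j) S a b)
        = (if j = 0 then - y0 else 0)"
      by (cases "j = 0") (simp_all add: sum_negf frob_def mult.commute)
  qed (use psdY SY in auto)
qed

text \<open>
  The matrix \<open>S\<close> of step \<open>i\<close>, whose range is the sum of the ranges of the earlier factors.
\<close>

definition gram_upto :: "nat \<Rightarrow> (nat \<Rightarrow> matrix) \<Rightarrow> nat \<Rightarrow> matrix" where
  "gram_upto d P i a b = (\<Sum>k<i. gram d (P k) a b)"

text \<open>
  In matrix notation \<open>P\<^sub>i P\<^sub>i\<^sup>T \<bullet> A\<^sub>j + R\<^sub>i \<bullet> (A\<^sub>j S\<^sub>i)\<close> where \<open>S\<^sub>i\<close> is the sum of the \<open>P\<^sub>k P\<^sub>k\<^sup>T\<close> for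
  \<open>k < i\<close>.
\<close>

definition residual ::
  "nat \<Rightarrow> (nat \<Rightarrow> matrix) \<Rightarrow> (nat \<Rightarrow> matrix) \<Rightarrow> (nat \<Rightarrow> matrix) \<Rightarrow> nat \<Rightarrow> nat \<Rightarrow> real" where
  "residual d A P R i j =
     frob d (gram d (P i)) (A j) + (\<Sum>a<d. \<Sum>b<d. R i a b * mmul d (A j) (gram_upto d P i) a b)"

text \<open>
  The number of steps is fixed to \<open>d + 1\<close>, so that the verifier does not have to read it from
  the certificate; shorter reductions are padded with zero matrices before their last step.
\<close>

definition certifies_infeasible ::
  "nat \<Rightarrow> nat \<Rightarrow> (nat \<Rightarrow> matrix) \<Rightarrow> (nat \<Rightarrow> matrix) \<Rightarrow> (nat \<Rightarrow> matrix) \<Rightarrow> bool" where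
  "certifies_infeasible d n A P R \<longleftrightarrow>
     (\<forall>i\<le>d. \<forall>j\<le>n. residual d A P R i j = (if i = d \<and> j = 0 then -1 else 0))"

lemma frob_gram: "frob d (gram d P) X = (\<Sum>c<d. bil d X (\<lambda>a. P a c) (\<lambda>a. P a c))"
proof -
  have "frob d (gram d P) X = (\<Sum>a<d. \<Sum>b<d. \<Sum>c<d. P a c * X a b * P b c)"
    by (simp add: frob_def gram_def sum_distrib_left sum_distrib_right mult_ac)
  also have "\<dots> = (\<Sum>a<d. \<Sum>c<d. \<Sum>b<d. P a c * X a b * P b c)"
    by (intro sum.cong refl sum.swap)
  also have "\<dots> = (\<Sum>c<d. \<Sum>a<d. \<Sum>b<d. P a c * X a b * P b c)" by (rule sum.swap)
  finally show ?thesis by (simp add: bil_sum)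
qed

text \<open>
  For a positive semidefinite member \<open>X\<close> of the pencil, \<open>X S\<^sub>i = 0\<close> follows by induction on
  \<open>i\<close>: the equations of step \<open>i\<close>, combined with the coefficients of \<open>X\<close>, give
  \<open>P\<^sub>i P\<^sub>i\<^sup>T \<bullet> X = 0\<close>, which is the sum of the values of the form of \<open>X\<close> at the columns of \<open>P\<^sub>i\<close>.
\<close>

lemma infeasibility_certificate_sound:
  assumes cert: "certifies_infeasible d n A P R" and X: "psd d (pencil n A x)"
  shows False
proof -
  define X where "X = pencil n A x"
  have comb: "frob d (gram d (P i)) X + (\<Sum>a<d. \<Sum>b<d. R i a b * mmul d X (gram_upto d P i) a b)
      = residual d A P R i 0 + (\<Sum>j<n. x j * residual d A P R i (Suc j))" for i
  proof -
    have 1: "frob d (gram d (P i)) X = frob d (gram d (P i)) (A 0) + (\<Sum>j<n. x j * frob d (gram d (P i)) (A (Suc j)))"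
    proof -
      let ?G = "gram d (P i)"
      have "(\<Sum>j<n. x j * frob d ?G (A (Suc j))) = (\<Sum>a<d. \<Sum>b<d. \<Sum>j<n. ?G a b * (x j * A (Suc j) a b))"
        unfolding frob_def sum_distrib_left
        by (subst sum.swap) (simp add: mult.left_commute sum.swap[of _ "{..<d}" "{..<n}"])
      then show ?thesis
        by (simp add: frob_def X_def pencil_def distrib_left sum.distrib flip: sum_distrib_left)
    qed
    have mmX: "mmul d X S a b = mmul d (A 0) S a b + (\<Sum>j<n. x j * mmul d (A (Suc j)) S a b)" for S a b
    proof -
      have "(\<Sum>j<n. x j * mmul d (A (Suc j)) S a b) = (\<Sum>c<d. \<Sum>j<n. x j * A (Suc j) a c * S c b)"
        unfolding mmul_def sum_distrib_left by (subst sum.swap) (simp add: mult.assoc)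
      then show ?thesis
        by (simp add: mmul_def X_def pencil_def distrib_right sum.distrib flip: sum_distrib_right)
    qed
    have 2: "(\<Sum>a<d. \<Sum>b<d. R i a b * mmul d X (gram_upto d P i) a b)
       = (\<Sum>a<d. \<Sum>b<d. R i a b * mmul d (A 0) (gram_upto d P i) a b)
       + (\<Sum>j<n. x j * (\<Sum>a<d. \<Sum>b<d. R i a b * mmul d (A (Suc j)) (gram_upto d P i) a b))"
    proof -
      let ?m = "\<lambda>j a b. mmul d (A j) (gram_upto d P i) a b"
      have "(\<Sum>j<n. x j * (\<Sum>a<d. \<Sum>b<d. R i a b * ?m (Suc j) a b))
          = (\<Sum>a<d. \<Sum>b<d. \<Sum>j<n. R i a b * (x j * ?m (Suc j) a b))"
        unfolding sum_distrib_left
        by (subst sum.swap) (simp add: mult.left_commute sum.swap[of _ "{..<d}" "{..<n}"])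
      then show ?thesis
        by (simp add: mmX distrib_left sum.distrib flip: sum_distrib_left)
    qed
    show ?thesis unfolding 1 2 residual_def by (simp add: distrib_left sum.distrib)
  qed
  have zero: "mmul d X (gram_upto d P i) a b = 0" if "i \<le> d" "a < d" "b < d" for i a b
    using that
  proof (induction i arbitrary: a b)
    case 0
    then show ?case by (simp add: mmul_def gram_upto_def)
  next
    case (Suc i)
    have IH: "mmul d X (gram_upto d P i) a b = 0" if "a < d" "b < d" for a b using Suc that by simp
    have "frob d (gram d (P i)) X = 0"
      using comb[of i] IH cert Suc.prems(1) by (simp add: certifies_infeasible_def)
    then have "\<forall>c\<in>{..<d}. bil d X (\<lambda>a. P i a c) (\<lambda>a. P i a c) = 0"
      unfolding frob_gram using X by (subst (asm) sum_nonneg_eq_0_iff) (auto simp: psd_def X_def)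
    then have "(\<Sum>b<d. X a b * P i b c) = 0" if "c < d" for c
      using psd_kernel[of d X "\<lambda>b. P i b c" a] X Suc.prems that by (simp add: X_def)
    then have "(\<Sum>c<d. (\<Sum>e<d. X a e * P i e c) * P i b c) = 0" by simp
    moreover have "mmul d X (gram d (P i)) a b = (\<Sum>c<d. (\<Sum>e<d. X a e * P i e c) * P i b c)"
      unfolding mmul_def gram_def sum_distrib_left sum_distrib_right
      by (subst sum.swap) (simp add: mult_ac)
    moreover have "mmul d X (gram_upto d P (Suc i)) a b = mmul d X (gram_upto d P i) a b + mmul d X (gram d (P i)) a b"
      by (simp add: mmul_def gram_upto_def distrib_left sum.distrib)
    ultimately show ?case using IH Suc.prems by simp
  qed
  have "0 \<le> frob d (gram d (P d)) X"
    unfolding frob_gram using X by (intro sum_nonneg) (auto simp: psd_def X_def)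
  moreover have "frob d (gram d (P d)) X = - 1"
    using comb[of d] zero[of d] cert by (simp add: certifies_infeasible_def)
  ultimately show False by simp
qed

text \<open>
  A reduction with \<open>m\<close> unfinished steps. Column \<open>c i\<close> of \<open>P i\<close> witnesses that step \<open>i\<close> makes
  progress: it is nonzero and orthogonal to all columns of the earlier factors.
\<close>

definition reduction_chain ::
  "nat \<Rightarrow> nat \<Rightarrow> (nat \<Rightarrow> matrix) \<Rightarrow> (nat \<Rightarrow> matrix) \<Rightarrow> (nat \<Rightarrow> matrix) \<Rightarrow> (nat \<Rightarrow> nat) \<Rightarrow> nat \<Rightarrow> bool" where
  "reduction_chain d n A P R c m \<longleftrightarrow>
     (\<forall>i<m. (\<forall>j\<le>n. residual d A P R i j = 0) \<and> c i < d \<and> (\<exists>a<d. P i a (c i) \<noteq> 0) \<and>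
        (\<forall>k<i. \<forall>e<d. (\<Sum>a<d. P k a e * P i a (c i)) = 0))"

lemma reduction_chain_length:
  assumes "reduction_chain d n A P R c m"
  shows "m \<le> d"
proof (rule orthogonal_family_le[of m d "\<lambda>i a. P i a (c i)"])
  show "\<exists>a<d. P i a (c i) \<noteq> 0" if "i < m" for i
    using assms that by (auto simp: reduction_chain_def)
  show "(\<Sum>a<d. P k a (c k) * P i a (c i)) = 0" if "i < m" "k < i" for i k
    using assms that by (simp add: reduction_chain_def)
qed

lemma gram_cong: "(\<And>c. c < d \<Longrightarrow> P a c = P' a c) \<Longrightarrow> (\<And>c. c < d \<Longrightarrow> P b c = P' b c) \<Longrightarrow>
    gram d P a b = gram d P' a b"
  by (simp add: gram_def)

lemma residual_cong:
  assumes P: "\<And>k a c. k \<le> i \<Longrightarrow> a < d \<Longrightarrow> c < d \<Longrightarrow> P k a c = P' k a c"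
    and R: "\<And>a b. a < d \<Longrightarrow> b < d \<Longrightarrow> R i a b = R' i a b"
    and A: "\<And>a b. a < d \<Longrightarrow> b < d \<Longrightarrow> A j a b = A' j a b"
  shows "residual d A P R i j = residual d A' P' R' i j"
proof -
  have gram: "gram d (P k) a b = gram d (P' k) a b" if "k \<le> i" "a < d" "b < d" for k a b
    using P that by (intro gram_cong) auto
  have gram_upto: "gram_upto d P i a b = gram_upto d P' i a b" if "a < d" "b < d" for a b
    unfolding gram_upto_def using gram that by (intro sum.cong) auto
  show ?thesis
    unfolding residual_def frob_def mmul_def
    by (intro arg_cong2[where f = "(+)"] sum.cong refl arg_cong2[where f = "(*)"])
       (auto simp: gram gram_upto R A)
qed

text \<open>
  Starting from the empty chain, every facial step either completes a certificate (\<open>y0 > 0\<close>,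
  after scaling by \<open>1 / y0\<close>) or prolongs the chain (\<open>y0 = 0\<close>). In the second case \<open>Y\<close> has
  positive trace, so that its factor \<open>G\<close> has a nonzero column, and \<open>S Y = 0\<close> makes the columns
  of \<open>G\<close> orthogonal to those of all earlier factors. Chains longer than \<open>d\<close> do not exist.
\<close>

lemma infeasibility_certificate_complete:
  assumes symA: "\<And>j. j \<le> n \<Longrightarrow> symm d (A j)"
    and infeasible: "\<And>x. \<not> psd d (pencil n A x)"
  shows "\<exists>P R. certifies_infeasible d n A P R"
proof (rule ccontr)
  assume none: "\<nexists>P R. certifies_infeasible d n A P R"
  have "\<exists>P R c. reduction_chain d n A P R c m" for m
  proof (induction m)
    case 0
    show ?case by (simp add: reduction_chain_def)
  next
    case (Suc m)
    then obtain P R c where chain: "reduction_chain d n A P R c m" by blast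
    let ?S = "gram_upto d P m"
    have symS: "symm d ?S" by (simp add: symm_def gram_upto_def gram_def mult.commute)
    obtain Y Q y0 where Y: "psd d Y" "\<forall>a<d. \<forall>b<d. mmul d ?S Y a b = 0"
      and y0: "0 \<le> y0" "0 < (\<Sum>a<d. Y a a) + y0"
      and Q: "\<forall>j\<le>n. frob d Y (A j) + (\<Sum>a<d. \<Sum>b<d. Q a b * mmul d (A j) ?S a b)
          = (if j = 0 then - y0 else 0)"
      using facial_step[OF symA symS infeasible] by blast
    obtain G where G: "\<And>a b. a < d \<Longrightarrow> b < d \<Longrightarrow> Y a b = gram d G a b"
      using psd_is_gram[OF Y(1)] by blast
    have ipG: "frob d (gram d G) Z = frob d Y Z" for Z
      unfolding frob_def by (intro sum.cong refl) (simp add: G)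
    show ?case
    proof (cases "y0 = 0")
      case False
      then have pos: "0 < y0" using y0 by simp
      define P' where "P' = (\<lambda>i. if i < m then P i else if i = d then (\<lambda>a b. G a b / sqrt y0) else 0)"
      define R' where "R' = (\<lambda>i. if i < m then R i else if i = d then (\<lambda>a b. Q a b / y0) else 0)"
      have md: "m \<le> d" using reduction_chain_length[OF chain] .
      have early: "residual d A P' R' i j = 0" if "i < m" "j \<le> n" for i j
      proof -
        have "residual d A P' R' i j = residual d A P R i j"
          using that by (intro residual_cong) (auto simp: P'_def R'_def)
        then show ?thesis using chain that by (simp add: reduction_chain_def)
      qed
      have mid: "residual d A P' R' i j = 0" if "m \<le> i" "i < d" for i j
        using that by (simp add: residual_def P'_def R'_def gram_def frob_def)
      have accd: "gram_upto d P' d a b = gram_upto d P m a b" for a b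
      proof -
        have "gram_upto d P' d a b = (\<Sum>k<m. gram d (P' k) a b)"
          unfolding gram_upto_def using md
          by (intro sum.mono_neutral_right) (auto simp: P'_def gram_def)
        then show ?thesis by (simp add: gram_upto_def P'_def)
      qed
      have gramd: "gram d (P' d) a b = gram d G a b / y0" for a b
        using md pos by (simp add: P'_def gram_def sum_divide_distrib)
      have final: "residual d A P' R' d j = (if j = 0 then - 1 else 0)" if "j \<le> n" for j
      proof -
        have "residual d A P' R' d j
            = (frob d Y (A j) + (\<Sum>a<d. \<Sum>b<d. Q a b * mmul d (A j) ?S a b)) / y0"
        proof -
          have "frob d (gram d (P' d)) (A j) = frob d Y (A j) / y0"
            unfolding ipG[symmetric] by (simp add: frob_def gramd sum_divide_distrib)
          moreover have "gram_upto d P' d = ?S" using accd by (simp add: fun_eq_iff)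
          moreover have "R' d a b = Q a b / y0" for a b using md by (simp add: R'_def)
          ultimately show ?thesis
            by (simp add: residual_def add_divide_distrib sum_divide_distrib)
        qed
        then show ?thesis using Q that pos by simp
      qed
      have "certifies_infeasible d n A P' R'"
        unfolding certifies_infeasible_def
      proof (intro allI impI)
        fix i j assume "i \<le> d" "j \<le> n"
        then consider "i < m" | "m \<le> i" "i < d" | "i = d" "m \<le> i" by linarith
        then show "residual d A P' R' i j = (if i = d \<and> j = 0 then -1 else 0)"
          by cases (use early[of i j] mid[of i j] final[of j] \<open>j \<le> n\<close> md in auto)
      qed
      then show ?thesis using none by blast
    next
      case True
      then have "(\<Sum>a<d. Y a a) \<noteq> 0" using y0(2) by simp
      then obtain a where a: "a < d" "Y a a \<noteq> 0"
        by (elim sum.not_neutral_contains_not_neutral) simp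
      then have "(\<Sum>e<d. G a e * G a e) \<noteq> 0" using G[of a a] by (simp add: gram_def)
      then have "\<exists>e<d. G a e \<noteq> 0"
        by (elim sum.not_neutral_contains_not_neutral) auto
      then obtain e where e: "e < d" "G a e \<noteq> 0" by blast
      \<comment> \<open>The squared entries in a row of \<open>S G\<close> add up to a diagonal entry of \<open>S Y S = 0\<close>.\<close>
      have SG: "(\<Sum>b<d. ?S a b * G b f) = 0" if "a < d" "f < d" for a f
      proof -
        have "(\<Sum>f<d. (\<Sum>b<d. ?S a b * G b f)\<^sup>2) = (\<Sum>b<d. mmul d ?S Y a b * ?S a b)"
        proof -
          have "mmul d ?S Y a b = (\<Sum>f<d. (\<Sum>k<d. ?S a k * G k f) * G b f)" if "b < d" for b
          proof -
            have "mmul d ?S Y a b = (\<Sum>k<d. \<Sum>f<d. ?S a k * G k f * G b f)"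
              unfolding mmul_def using that by (intro sum.cong refl) (simp add: G gram_def sum_distrib_left mult_ac)
            then show ?thesis by (subst (asm) sum.swap) (simp add: sum_distrib_right)
          qed
          then have "(\<Sum>b<d. mmul d ?S Y a b * ?S a b)
              = (\<Sum>b<d. \<Sum>f<d. (\<Sum>k<d. ?S a k * G k f) * (?S a b * G b f))"
            by (intro sum.cong refl) (simp add: sum_distrib_left sum_distrib_right mult_ac)
          also have "\<dots> = (\<Sum>f<d. (\<Sum>k<d. ?S a k * G k f) * (\<Sum>b<d. ?S a b * G b f))"
            by (subst sum.swap) (simp add: sum_distrib_left)
          finally show ?thesis by (simp add: power2_eq_square)
        qed
        also have "\<dots> = 0" using Y(2) \<open>a < d\<close> by simp
        finally have "\<forall>f\<in>{..<d}. (\<Sum>b<d. ?S a b * G b f)\<^sup>2 = 0"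
          by (subst (asm) sum_nonneg_eq_0_iff) auto
        then show ?thesis using \<open>f < d\<close> by simp
      qed
      \<comment> \<open>For a column \<open>p\<close> of \<open>G\<close>, the form of \<open>S\<close> at \<open>p\<close> is the sum of the squared inner
        products of \<open>p\<close> with the columns of the earlier factors.\<close>
      have orth: "(\<Sum>a<d. P k a f * G a e) = 0" if "k < m" "f < d" for k f
      proof -
        have "(\<Sum>k<m. \<Sum>f<d. (\<Sum>a<d. P k a f * G a e)\<^sup>2) = bil d ?S (\<lambda>a. G a e) (\<lambda>a. G a e)"
        proof -
          have "bil d ?S v v = (\<Sum>k<m. bil d (gram d (P k)) v v)" for v
          proof -
            have "bil d ?S v v = (\<Sum>a<d. \<Sum>b<d. \<Sum>k<m. v a * gram d (P k) a b * v b)"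
              by (simp add: bil_sum gram_upto_def sum_distrib_left sum_distrib_right)
            also have "\<dots> = (\<Sum>a<d. \<Sum>k<m. \<Sum>b<d. v a * gram d (P k) a b * v b)"
              by (intro sum.cong refl sum.swap)
            also have "\<dots> = (\<Sum>k<m. \<Sum>a<d. \<Sum>b<d. v a * gram d (P k) a b * v b)" by (rule sum.swap)
            finally show ?thesis by (simp add: bil_sum)
          qed
          then show ?thesis by (simp add: bil_gram)
        qed
        also have "\<dots> = 0" using SG e by (simp add: bil_def)
        finally have "\<forall>k\<in>{..<m}. (\<Sum>f<d. (\<Sum>a<d. P k a f * G a e)\<^sup>2) = 0"
          by (subst (asm) sum_nonneg_eq_0_iff) (auto intro: sum_nonneg)
        then have "(\<Sum>f<d. (\<Sum>a<d. P k a f * G a e)\<^sup>2) = 0" using that by simp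
        then have "\<forall>f\<in>{..<d}. (\<Sum>a<d. P k a f * G a e)\<^sup>2 = 0"
          by (subst (asm) sum_nonneg_eq_0_iff) auto
        then show ?thesis using that by simp
      qed
      have acc_upd: "gram_upto d (P(m := G)) m = ?S" by (simp add: gram_upto_def fun_eq_iff)
      let ?P = "P(m := G)" and ?R = "R(m := Q)" and ?c = "c(m := e)"
      have "residual d A ?P ?R m j = 0" if "j \<le> n" for j
        using Q that True by (simp add: residual_def ipG acc_upd)
      moreover have "residual d A ?P ?R i j = residual d A P R i j" if "i < m" for i j
        using that by (intro residual_cong) auto
      ultimately have "reduction_chain d n A ?P ?R ?c (Suc m)"
        using chain e a orth by (auto simp: reduction_chain_def less_Suc_eq)
      then show ?thesis by blast
    qed
  qed
  from this[of "Suc d"] show False using reduction_chain_length by fastforce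
qed

section \<open>Words encoding semidefinite programs\<close>

lemma index_less: "i < m \<Longrightarrow> r < d \<Longrightarrow> i * d + r < m * (d::nat)"
  using mult_le_mono1[of "Suc i" m d] by simp

lemma index3_less: "i < m \<Longrightarrow> a < d \<Longrightarrow> b < d \<Longrightarrow> (i * d + a) * d + b < m * d * (d::nat)"
  by (intro index_less)

lemma length_concat_const: "(\<And>xs. xs \<in> set xss \<Longrightarrow> length xs = m) \<Longrightarrow> length (concat xss) = length xss * m"
  by (induction xss) auto

lemma nth_concat_const:
  "(\<And>xs. xs \<in> set xss \<Longrightarrow> length xs = m) \<Longrightarrow> i < length xss \<Longrightarrow> j < m \<Longrightarrow>
   concat xss ! (i * m + j) = xss ! i ! j"
proof (induction xss arbitrary: i)
  case (Cons xs xss)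
  have "length xs = m" using Cons.prems by simp
  then show ?case using Cons by (cases i) (auto simp: nth_append)
qed simp

abbreviation matrix_of :: "real mat \<Rightarrow> matrix" where
  "matrix_of X a b \<equiv> X $$ (a, b)"

lemma bil_matrix_of:
  assumes "X \<in> carrier_mat d d" "v \<in> carrier_vec d"
  shows "v \<bullet> (X *\<^sub>v v) = bil d (matrix_of X) (vec_index v) (vec_index v)"
  using assms by (auto simp: scalar_prod_def bil_def atLeast0LessThan intro!: sum.cong)

lemma psd_cone_iff:
  assumes X: "X \<in> carrier_mat d d"
  shows "X \<in> psd_cone d \<longleftrightarrow> psd d (matrix_of X)"
proof -
  have sym: "transpose_mat X = X \<longleftrightarrow> symm d (matrix_of X)"
  proof
    assume "transpose_mat X = X"
    then show "symm d (matrix_of X)"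
      using X unfolding symm_def by (metis carrier_matD index_transpose_mat(1))
  next
    assume "symm d (matrix_of X)"
    then show "transpose_mat X = X" using X by (intro eq_matI) (auto simp: symm_def)
  qed
  have "(\<forall>v\<in>carrier_vec d. 0 \<le> v \<bullet> (X *\<^sub>v v)) \<longleftrightarrow> (\<forall>v. 0 \<le> bil d (matrix_of X) v v)"
  proof
    assume pos: "\<forall>v\<in>carrier_vec d. 0 \<le> v \<bullet> (X *\<^sub>v v)"
    show "\<forall>v. 0 \<le> bil d (matrix_of X) v v"
    proof
      fix v
      have "0 \<le> bil d (matrix_of X) (vec_index (vec d v)) (vec_index (vec d v))"
        using pos[rule_format, of "vec d v"] bil_matrix_of[OF X, of "vec d v"] by simp
      also have "\<dots> = bil d (matrix_of X) v v" by (simp add: bil_def)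
      finally show "0 \<le> bil d (matrix_of X) v v" .
    qed
  qed (use bil_matrix_of[OF X] in simp)
  then show ?thesis using X sym by (simp add: psd_cone_def sym_mats_def psd_def)
qed

lemma psd_cong:
  assumes "\<And>a b. a < d \<Longrightarrow> b < d \<Longrightarrow> X a b = X' a b"
  shows "psd d X \<longleftrightarrow> psd d X'"
  using assms by (simp add: psd_def symm_def bil_def)

definition entry :: "real list \<Rightarrow> nat \<Rightarrow> nat \<Rightarrow> matrix" where
  "entry u d j a b = padded u (2 + ((j * d + a) * d + b))"

lemma encode_sdp_entries:
  assumes "sdp_instance d A0 As"
  defines "u \<equiv> encode_sdp d A0 As" and "n \<equiv> length As"
  shows "length u = 2 + (n + 1) * d * d"
    and "\<And>j a b. j \<le> n \<Longrightarrow> a < d \<Longrightarrow> b < d \<Longrightarrow> entry u d j a b = ((A0 # As) ! j) $$ (a, b)"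
proof -
  have carrier: "X \<in> carrier_mat d d" if "X \<in> set (A0 # As)" for X
    using assms that by (auto simp: sdp_instance_def sym_mats_def)
  have rows: "length xs = d" if "X \<in> set (A0 # As)" "xs \<in> set (mat_to_list X)" for X xs
    using carrier[OF that(1)] that(2) by (auto simp: mat_to_list_def)
  have len: "length (mat_to_list X) = d" if "X \<in> set (A0 # As)" for X
    using carrier[OF that] by (auto simp: mat_to_list_def)
  have mat_len: "length (concat (mat_to_list X)) = d * d" if "X \<in> set (A0 # As)" for X
    using length_concat_const[OF rows[OF that]] len[OF that] by simp
  define cs where "cs = map (\<lambda>A. concat (mat_to_list A)) (A0 # As)"
  have u: "u = real d # real n # concat cs" by (simp only: u_def n_def cs_def encode_sdp_def)
  have cs: "length xs = d * d" if "xs \<in> set cs" for xs using that mat_len by (auto simp: cs_def)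
  have len_cs: "length cs = Suc n" by (simp add: cs_def n_def)
  have "length (concat cs) = Suc n * (d * d)" using length_concat_const[OF cs] len_cs by simp
  then show l: "length u = 2 + (n + 1) * d * d" unfolding u by (simp add: algebra_simps)
  fix j a b assume j: "j \<le> n" and ab: "a < d" "b < d"
  let ?X = "(A0 # As) ! j"
  have X: "?X \<in> set (A0 # As)" using j by (intro nth_mem) (simp add: n_def)
  have "entry u d j a b = u ! (2 + ((j * d + a) * d + b))"
    using index3_less[of j "n + 1" a d b] j ab unfolding entry_def padded_def l by simp
  also have "\<dots> = concat cs ! ((j * d + a) * d + b)" unfolding u by simp
  also have "(j * d + a) * d + b = j * (d * d) + (a * d + b)" by (simp add: algebra_simps)
  also have "concat cs ! (j * (d * d) + (a * d + b)) = cs ! j ! (a * d + b)"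
    by (rule nth_concat_const[OF cs]) (use j ab index_less[of a d b d] len_cs in auto)
  also have "cs ! j = concat (mat_to_list ?X)"
    using j unfolding cs_def by (subst nth_map) (auto simp: n_def)
  also have "\<dots> ! (a * d + b) = mat_to_list ?X ! a ! b"
    by (rule nth_concat_const[OF rows[OF X]]) (use len[OF X] ab in auto)
  also have "\<dots> = ?X $$ (a, b)" using carrier[OF X] ab by (simp add: mat_to_list_def)
  finally show "entry u d j a b = ?X $$ (a, b)" .
qed

text \<open>
  In dimension \<open>0\<close> linear independence leaves no room for \<open>A\<^sub>1\<close>. In positive dimension the
  length of the word bounds \<open>n\<close>, so \<open>n\<close> is bounded by the size of the instance in every case.
\<close>

lemma sdp_instance_length: "sdp_instance 0 A0 As \<Longrightarrow> length As = 0"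
proof (rule ccontr)
  assume inst: "sdp_instance 0 A0 As" and "length As \<noteq> 0"
  let ?x = "vec (length As) (\<lambda>_. 1) :: real vec"
  have "lin_comb 0 As ?x = 0\<^sub>m 0 0" by (intro eq_matI) (auto simp: lin_comb_def)
  then have "?x = 0\<^sub>v (length As)"
    using inst by (auto simp: sdp_instance_def lin_indep_mats_def)
  then have "?x $ 0 = 0\<^sub>v (length As) $ 0" by simp
  then show False using \<open>length As \<noteq> 0\<close> by simp
qed

lemma feasible_iff:
  assumes inst: "sdp_instance d A0 As"
  shows "psd_cone d \<inter> affine_space d A0 As \<noteq> {} \<longleftrightarrow>
         (\<exists>x. psd d (pencil (length As) (entry (encode_sdp d A0 As) d) x))"
proof -
  let ?A = "entry (encode_sdp d A0 As) d" and ?n = "length As"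
  let ?X = "\<lambda>x. A0 + lin_comb d As x"
  have A0: "A0 \<in> carrier_mat d d" using inst by (simp add: sdp_instance_def sym_mats_def)
  then have carrier: "?X x \<in> carrier_mat d d" for x by (simp add: lin_comb_def)
  have "psd d (matrix_of (?X x)) \<longleftrightarrow> psd d (pencil ?n ?A (vec_index x))" for x
  proof (rule psd_cong)
    fix a b assume ab: "a < d" "b < d"
    have "?A 0 a b = A0 $$ (a, b)" "?A (Suc j) a b = As ! j $$ (a, b)" if "j < ?n" for j
      using encode_sdp_entries(2)[OF inst, of 0 a b] encode_sdp_entries(2)[OF inst, of "Suc j" a b] ab that
      by simp_all
    moreover have "?A 0 a b = A0 $$ (a, b)"
      using encode_sdp_entries(2)[OF inst, of 0 a b] ab by simp
    ultimately show "matrix_of (?X x) a b = pencil ?n ?A (vec_index x) a b"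
      using A0 ab by (simp add: lin_comb_def pencil_def)
  qed
  then have iff: "?X x \<in> psd_cone d \<longleftrightarrow> psd d (pencil ?n ?A (vec_index x))" for x
    using psd_cone_iff[OF carrier] by simp
  have "pencil ?n ?A (vec_index (vec ?n x)) = pencil ?n ?A x" for x
    by (simp add: pencil_def fun_eq_iff)
  then have "?X (vec ?n x) \<in> psd_cone d \<longleftrightarrow> psd d (pencil ?n ?A x)" for x using iff by simp
  note vec = this
  show ?thesis
  proof
    assume "psd_cone d \<inter> affine_space d A0 As \<noteq> {}"
    then obtain x where "?X x \<in> psd_cone d" unfolding affine_space_def by blast
    then show "\<exists>x. psd d (pencil ?n ?A x)" using iff by blast
  next
    assume "\<exists>x. psd d (pencil ?n ?A x)"
    then obtain x where "psd d (pencil ?n ?A x)" ..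
    then have "?X (vec ?n x) \<in> psd_cone d" using vec by simp
    moreover have "?X (vec ?n x) \<in> affine_space d A0 As"
      unfolding affine_space_def using vec_carrier[of ?n x] by blast
    ultimately show "psd_cone d \<inter> affine_space d A0 As \<noteq> {}" by blast
  qed
qed

section \<open>The two verifying expressions\<close>

abbreviation "dim_var \<equiv> IVar 0"
abbreviation "num_var \<equiv> IVar 1"

text \<open>
  The position of entry \<open>(a, b)\<close> of the \<open>i\<close>-th matrix in a list of square matrices written row
  by row.
\<close>

definition cell :: "iexp \<Rightarrow> iexp \<Rightarrow> iexp \<Rightarrow> iexp" where
  "cell i a b = IAdd (IMul (IAdd (IMul i dim_var) a) dim_var) b"

text \<open>
  Three letters precede the matrices in a pair: the length of the instance, \<open>d\<close> and \<open>n\<close>.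
\<close>

definition input_cell :: "iexp \<Rightarrow> iexp \<Rightarrow> iexp \<Rightarrow> rexp" where
  "input_cell j a b = RInp (IAdd (IConst 3) (cell j a b))"

definition cert_cell :: "iexp \<Rightarrow> rexp" where
  "cert_cell k = RInp (IAdd (IAdd (IConst 3) (IMul (IMul (IAdd num_var (IConst 1)) dim_var) dim_var)) k)"

definition square :: "rexp \<Rightarrow> rexp" where
  "square e = RMul e e"

text \<open>
  The certificate consists of \<open>x\<close>, followed by a factor \<open>P\<close> of \<open>A(x)\<close>.
\<close>

definition feasible_expr :: rexp where
  "feasible_expr = RSum 2 dim_var (RSum 3 dim_var (square (RAdd
     (RAdd (input_cell (IConst 0) (IVar 2) (IVar 3))
       (RSum 4 num_var (RMul (cert_cell (IVar 4)) (input_cell (IAdd (IVar 4) (IConst 1)) (IVar 2) (IVar 3)))))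
     (RMul (RConst (-1)) (RSum 4 dim_var (RMul
        (cert_cell (IAdd num_var (IAdd (IMul (IVar 2) dim_var) (IVar 4))))
        (cert_cell (IAdd num_var (IAdd (IMul (IVar 3) dim_var) (IVar 4))))))))))"

definition P_cert :: "iexp \<Rightarrow> iexp \<Rightarrow> iexp \<Rightarrow> rexp" where
  "P_cert i a c = cert_cell (cell i a c)"

definition R_cert :: "iexp \<Rightarrow> iexp \<Rightarrow> iexp \<Rightarrow> rexp" where
  "R_cert i a b = cert_cell (IAdd (IMul (IMul (IAdd dim_var (IConst 1)) dim_var) dim_var) (cell i a b))"

definition residual_expr :: "iexp \<Rightarrow> iexp \<Rightarrow> rexp" where
  "residual_expr i j = RAdd
     (RSum 4 dim_var (RSum 5 dim_var (RMul
        (RSum 6 dim_var (RMul (P_cert i (IVar 4) (IVar 6)) (P_cert i (IVar 5) (IVar 6))))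
        (input_cell j (IVar 4) (IVar 5)))))
     (RSum 4 dim_var (RSum 5 dim_var (RMul (R_cert i (IVar 4) (IVar 5))
        (RSum 6 dim_var (RMul (input_cell j (IVar 4) (IVar 6))
           (RSum 7 i (RSum 8 dim_var (RMul
              (P_cert (IVar 7) (IVar 6) (IVar 8)) (P_cert (IVar 7) (IVar 5) (IVar 8))))))))))"

text \<open>
  The certificate consists of \<open>P\<^sub>0, \<dots>, P\<^sub>d\<close>, followed by \<open>R\<^sub>0, \<dots>, R\<^sub>d\<close>. Summed are the squares of
  the residuals of the unfinished steps, those of the last step for \<open>j \<ge> 1\<close>, and that of its
  residual for \<open>j = 0\<close> increased by \<open>1\<close>.
\<close>

definition infeasible_expr :: rexp where
  "infeasible_expr = RAdd
     (RSum 2 dim_var (RSum 3 (IAdd num_var (IConst 1)) (square (residual_expr (IVar 2) (IVar 3)))))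
     (RAdd (RSum 3 num_var (square (residual_expr dim_var (IAdd (IVar 3) (IConst 1)))))
       (square (RAdd (residual_expr dim_var (IConst 0)) (RConst 1))))"

definition input_matrix :: "nat \<Rightarrow> (nat \<Rightarrow> real) \<Rightarrow> nat \<Rightarrow> matrix" where
  "input_matrix d y j a b = y (3 + ((j * d + a) * d + b))"

definition witness :: "nat \<Rightarrow> nat \<Rightarrow> (nat \<Rightarrow> real) \<Rightarrow> nat \<Rightarrow> real" where
  "witness d n y k = y (3 + (n + 1) * d * d + k)"

definition P_of :: "nat \<Rightarrow> (nat \<Rightarrow> real) \<Rightarrow> nat \<Rightarrow> matrix" where
  "P_of d w i a c = w ((i * d + a) * d + c)"

definition R_of :: "nat \<Rightarrow> (nat \<Rightarrow> real) \<Rightarrow> nat \<Rightarrow> matrix" where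
  "R_of d w i a b = w ((d + 1) * d * d + ((i * d + a) * d + b))"

lemma rval_feasible_expr:
  "rval feasible_expr (header d n) y =
     (\<Sum>a<d. \<Sum>b<d. (pencil n (input_matrix d y) (witness d n y) a b
        - gram d (\<lambda>a c. witness d n y (n + (a * d + c))) a b)\<^sup>2)"
  by (simp add: feasible_expr_def square_def input_cell_def cert_cell_def cell_def header_def pencil_def
      gram_def input_matrix_def witness_def power2_eq_square)

text \<open>
  Variables from \<open>4\<close> on are bound inside the expression, so \<open>i\<close> and \<open>j\<close> may depend on smaller
  ones only.
\<close>

lemma rval_residual_expr:
  assumes "env 0 = d" "env 1 = n"
    and i: "\<And>env'. (\<And>v. v < 4 \<Longrightarrow> env' v = env v) \<Longrightarrow> ival i env' = i'"
    and j: "\<And>env'. (\<And>v. v < 4 \<Longrightarrow> env' v = env v) \<Longrightarrow> ival j env' = j'"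
  shows "rval (residual_expr i j) env y =
     residual d (input_matrix d y) (P_of d (witness d n y)) (R_of d (witness d n y)) i' j'"
  using assms(1,2)
  by (simp add: residual_expr_def input_cell_def P_cert_def R_cert_def cert_cell_def cell_def i j
      residual_def frob_def mmul_def gram_def gram_upto_def input_matrix_def P_of_def R_of_def witness_def)

lemma rval_infeasible_expr:
  fixes y :: "nat \<Rightarrow> real" and d n :: nat
  defines "r \<equiv> residual d (input_matrix d y) (P_of d (witness d n y)) (R_of d (witness d n y))"
  shows "rval infeasible_expr (header d n) y =
     (\<Sum>i<d. \<Sum>j<n + 1. (r i j)\<^sup>2) + ((\<Sum>j<n. (r d (j + 1))\<^sup>2) + (r d 0 + 1)\<^sup>2)"
proof -
  have 1: "rval (residual_expr (IVar 2) (IVar 3)) ((header d n)(2 := i, 3 := j)) y = r i j" for i j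
    unfolding r_def by (rule rval_residual_expr) (auto simp: header_def)
  have 2: "rval (residual_expr dim_var (IAdd (IVar 3) (IConst 1))) ((header d n)(3 := j)) y = r d (j + 1)" for j
    unfolding r_def by (rule rval_residual_expr) (auto simp: header_def)
  have 3: "rval (residual_expr dim_var (IConst 0)) (header d n) y = r d 0"
    unfolding r_def by (rule rval_residual_expr) (auto simp: header_def)
  show ?thesis
    by (simp add: infeasible_expr_def square_def 1 2[simplified] 3 power2_eq_square)
       (simp add: header_def)
qed

lemma infeasible_expr_le_0_iff:
  "rval infeasible_expr (header d n) y \<le> 0 \<longleftrightarrow>
   certifies_infeasible d n (input_matrix d y) (P_of d (witness d n y)) (R_of d (witness d n y))"
proof -
  define r where "r = residual d (input_matrix d y) (P_of d (witness d n y)) (R_of d (witness d n y))"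
  have le0: "x + y \<le> 0 \<longleftrightarrow> x = 0 \<and> y = 0" if "0 \<le> x" "0 \<le> y" for x y :: real using that by linarith
  have double: "(\<Sum>i<d. \<Sum>j<m. (r i j)\<^sup>2) = 0 \<longleftrightarrow> (\<forall>i<d. \<forall>j<m. r i j = 0)" for m
    by (simp add: sum_nonneg_eq_0_iff sum_nonneg Ball_def)
  have "rval infeasible_expr (header d n) y \<le> 0 \<longleftrightarrow>
      (\<Sum>i<d. \<Sum>j<n + 1. (r i j)\<^sup>2) = 0 \<and> (\<Sum>j<n. (r d (j + 1))\<^sup>2) = 0 \<and> r d 0 = -1"
    unfolding rval_infeasible_expr r_def[symmetric]
    by (subst le0, (auto intro!: sum_nonneg add_nonneg_nonneg)[2])
       (subst add_nonneg_eq_0_iff, auto intro!: sum_nonneg)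
  also have "\<dots> \<longleftrightarrow> (\<forall>i<d. \<forall>j<n + 1. r i j = 0) \<and> (\<forall>j<n. r d (j + 1) = 0) \<and> r d 0 = -1"
    unfolding double by (simp add: sum_nonneg_eq_0_iff Ball_def)
  also have "\<dots> \<longleftrightarrow> (\<forall>i\<le>d. \<forall>j\<le>n. r i j = (if i = d \<and> j = 0 then -1 else 0))"
  proof -
    have "(\<forall>j\<le>n. r d j = (if j = 0 then -1 else 0)) \<longleftrightarrow> (\<forall>j<n. r d (j + 1) = 0) \<and> r d 0 = -1"
      by (force simp: gr0_conv_Suc Suc_le_eq)
    moreover have "(\<forall>i\<le>d. Q i) \<longleftrightarrow> (\<forall>i<d. Q i) \<and> Q d" for Q :: "nat \<Rightarrow> bool"
      by (auto simp: le_less)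
    ultimately show ?thesis by (auto simp: less_Suc_eq_le)
  qed
  finally show ?thesis by (simp add: certifies_infeasible_def r_def)
qed

lemma feasible_expr_le_0_iff:
  "rval feasible_expr (header d n) y \<le> 0 \<longleftrightarrow>
   (\<forall>a<d. \<forall>b<d. pencil n (input_matrix d y) (witness d n y) a b
        = gram d (\<lambda>a c. witness d n y (n + (a * d + c))) a b)"
proof -
  have "x \<le> 0 \<longleftrightarrow> x = 0" if "0 \<le> x" for x :: real using that by linarith
  then show ?thesis unfolding rval_feasible_expr
    by (subst \<open>\<And>x. 0 \<le> x \<Longrightarrow> (x \<le> 0) = (x = 0)\<close>) (auto simp: sum_nonneg_eq_0_iff sum_nonneg)
qed

locale sdp_word =
  fixes d :: nat and A0 :: "real mat" and As :: "real mat list" and u :: "real list" and n :: nat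
  assumes inst: "sdp_instance d A0 As" and u: "u = encode_sdp d A0 As" and n: "n = length As"
begin

lemma length_u: "length u = 2 + (n + 1) * d * d"
  using encode_sdp_entries(1)[OF inst] by (simp add: u n)

lemma size_bounds: "d \<le> length u" "n \<le> length u" "d * d \<le> length u"
proof -
  show "d * d \<le> length u" by (simp add: length_u algebra_simps)
  then show "d \<le> length u" using le_square[of d] by linarith
  show "n \<le> length u"
  proof (cases "d = 0")
    case True
    then show ?thesis using sdp_instance_length[of A0 As] inst by (simp add: n)
  next
    case False
    then have "n * 1 \<le> n * (d * d)" by (intro mult_le_mono2) simp
    moreover have "length u = 2 + n * (d * d) + d * d" by (simp add: length_u algebra_simps)
    ultimately show ?thesis by linarith
  qed
qed

lemma input_matrix_pair_word:
  assumes "j \<le> n" "a < d" "b < d"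
  shows "input_matrix d (padded (pair_word u w)) j a b = entry u d j a b"
proof -
  have "(j * d + a) * d + b < (n + 1) * d * d" using assms by (intro index3_less) auto
  then show ?thesis
    by (simp add: input_matrix_def entry_def padded_def pair_word_def length_u nth_append eval_nat_numeral)
qed

lemma witness_pair_word: "witness d n (padded (pair_word u w)) = padded w"
  by (auto simp: fun_eq_iff witness_def padded_def pair_word_def length_u nth_append eval_nat_numeral)

lemma symm_entry: "j \<le> n \<Longrightarrow> symm d (entry u d j)"
proof -
  assume j: "j \<le> n"
  have "(A0 # As) ! j \<in> set (A0 # As)" using j by (intro nth_mem) (simp add: n)
  then have X: "(A0 # As) ! j \<in> carrier_mat d d" "transpose_mat ((A0 # As) ! j) = (A0 # As) ! j"
    using inst by (auto simp: sdp_instance_def sym_mats_def)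
  have "(A0 # As) ! j $$ (a, b) = (A0 # As) ! j $$ (b, a)" if "a < d" "b < d" for a b
    using X that by (metis carrier_matD index_transpose_mat(1))
  then show ?thesis
    using encode_sdp_entries(2)[OF inst] j by (simp add: symm_def u n)
qed

lemma pencil_pair_word:
  assumes "a < d" "b < d"
  shows "pencil n (input_matrix d (padded (pair_word u w))) x a b = pencil n (entry u d) x a b"
  using assms by (simp add: pencil_def input_matrix_pair_word)

lemma feasible_witness_iff:
  "(\<exists>x. psd d (pencil n (entry u d) x)) \<longleftrightarrow>
   (\<exists>w. length w \<le> poly [:0, 2:] (length u) \<and> rval feasible_expr (header d n) (padded (pair_word u w)) \<le> 0)"
proof
  assume "\<exists>x. psd d (pencil n (entry u d) x)"
  then obtain x where "psd d (pencil n (entry u d) x)" ..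
  then obtain P where P: "\<And>a b. a < d \<Longrightarrow> b < d \<Longrightarrow> pencil n (entry u d) x a b = gram d P a b"
    using psd_is_gram by blast
  define w where "w = map x [0..<n] @ map (\<lambda>k. P (k div d) (k mod d)) [0..<d * d]"
  have wx: "padded w k = x k" if "k < n" for k using that by (simp add: padded_def w_def nth_append)
  have wP: "padded w (n + (a * d + c)) = P a c" if "a < d" "c < d" for a c
    using that index_less[of a d c d] by (simp add: padded_def w_def nth_append)
  have "pencil n (entry u d) (padded w) a b = gram d (\<lambda>a c. padded w (n + (a * d + c))) a b"
    if "a < d" "b < d" for a b
  proof -
    have "pencil n (entry u d) (padded w) a b = pencil n (entry u d) x a b"
      by (simp add: pencil_def wx)
    also have "\<dots> = gram d (\<lambda>a c. padded w (n + (a * d + c))) a b"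
      unfolding P[OF that] using that by (intro gram_cong) (auto simp: wP)
    finally show ?thesis .
  qed
  then have "rval feasible_expr (header d n) (padded (pair_word u w)) \<le> 0"
    unfolding feasible_expr_le_0_iff witness_pair_word by (simp add: pencil_pair_word)
  moreover have "length w \<le> poly [:0, 2:] (length u)"
    using size_bounds by (simp add: w_def)
  ultimately show "\<exists>w. length w \<le> poly [:0, 2:] (length u) \<and>
      rval feasible_expr (header d n) (padded (pair_word u w)) \<le> 0" by blast
next
  assume "\<exists>w. length w \<le> poly [:0, 2:] (length u) \<and>
      rval feasible_expr (header d n) (padded (pair_word u w)) \<le> 0"
  then obtain w where "\<And>a b. a < d \<Longrightarrow> b < d \<Longrightarrow>
      pencil n (entry u d) (padded w) a b = gram d (\<lambda>a c. padded w (n + (a * d + c))) a b"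
    unfolding feasible_expr_le_0_iff witness_pair_word by (auto simp: pencil_pair_word)
  then have "psd d (pencil n (entry u d) (padded w))"
    using psd_gram psd_cong by blast
  then show "\<exists>x. psd d (pencil n (entry u d) x)" by blast
qed

lemma certifies_pair_word:
  "certifies_infeasible d n (input_matrix d (padded (pair_word u w))) P R
   \<longleftrightarrow> certifies_infeasible d n (entry u d) P R"
proof -
  have "residual d (input_matrix d (padded (pair_word u w))) P R i j = residual d (entry u d) P R i j"
    if "j \<le> n" for i j
    using that by (intro residual_cong) (auto simp: input_matrix_pair_word)
  then show ?thesis by (simp add: certifies_infeasible_def)
qed

lemma infeasible_witness_iff:
  "(\<nexists>x. psd d (pencil n (entry u d) x)) \<longleftrightarrow>
   (\<exists>w. length w \<le> poly ([:0, 2:] * [:1, 1:]) (length u) \<and>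
        rval infeasible_expr (header d n) (padded (pair_word u w)) \<le> 0)"
  (is "?L \<longleftrightarrow> ?R")
proof
  assume ?L
  then obtain P R where PR: "certifies_infeasible d n (entry u d) P R"
    using infeasibility_certificate_complete[of n d "entry u d"] symm_entry by blast
  let ?S = "(d + 1) * d * d"
  define flat where "flat F = map (\<lambda>k. F (k div d div d) (k div d mod d) (k mod d)) [0..<?S]"
    for F :: "nat \<Rightarrow> matrix"
  define w where "w = flat P @ flat R"
  have len_flat: "length (flat F) = ?S" for F by (simp add: flat_def)
  have nth: "(i * d + a) * d + b < ?S \<and> flat F ! ((i * d + a) * d + b) = F i a b"
    if "i \<le> d" "a < d" "b < d" for F i a b
  proof -
    have "(i * d + a) * d + b < ?S" using that by (intro index3_less) auto
    moreover have "((i * d + a) * d + b) div d = i * d + a" "((i * d + a) * d + b) mod d = b"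
      "(i * d + a) div d = i" "(i * d + a) mod d = a" using that by auto
    ultimately show ?thesis unfolding flat_def by (simp del: mult_Suc add_mult_distrib)
  qed
  have wP: "P_of d (padded w) i a b = P i a b" if "i \<le> d" "a < d" "b < d" for i a b
    using nth[OF that, of P] len_flat by (simp add: P_of_def padded_def w_def nth_append)
  have wR: "R_of d (padded w) i a b = R i a b" if "i \<le> d" "a < d" "b < d" for i a b
    using nth[OF that, of R] len_flat by (simp add: R_of_def padded_def w_def nth_append)
  have "residual d (entry u d) (P_of d (padded w)) (R_of d (padded w)) i j = residual d (entry u d) P R i j"
    if "i \<le> d" for i j
    using that by (intro residual_cong) (auto simp: wP wR)
  then have "certifies_infeasible d n (entry u d) (P_of d (padded w)) (R_of d (padded w))"
    using PR by (simp add: certifies_infeasible_def)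
  then have "rval infeasible_expr (header d n) (padded (pair_word u w)) \<le> 0"
    by (simp add: infeasible_expr_le_0_iff witness_pair_word certifies_pair_word)
  moreover have "length w \<le> poly ([:0, 2:] * [:1, 1:]) (length u)"
  proof -
    have "(d + 1) * (d * d) \<le> (length u + 1) * length u"
      using size_bounds by (intro mult_le_mono) auto
    then show ?thesis by (simp add: w_def len_flat algebra_simps)
  qed
  ultimately show ?R by blast
next
  assume ?R
  then obtain w where
    "certifies_infeasible d n (entry u d) (P_of d (padded w)) (R_of d (padded w))"
    by (auto simp: infeasible_expr_le_0_iff witness_pair_word certifies_pair_word)
  then show ?L using infeasibility_certificate_sound by blast
qed

end

theorem theorem4p7:
  shows "SDP_feasibility \<in> NP_R \<inter> coNP_R"
proof -
  define B where "B = {encode_sdp d A0 As | d A0 As. sdp_instance d A0 As}"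
  define F where "F = {encode_sdp d A0 As | d A0 As. sdp_instance d A0 As \<and>
      psd_cone d \<inter> affine_space d A0 As \<noteq> {}}"
  have SDP: "SDP_feasibility = (B, F)" by (simp add: SDP_feasibility_def B_def F_def)
  have FB: "F \<subseteq> B" by (auto simp: F_def B_def)
  have word: "\<exists>A0 As. sdp_word d A0 As u n" if uB: "u \<in> B" and ud: "u = real d # real n # xs" for u d n xs
  proof -
    obtain d' A0 As where "sdp_instance d' A0 As" "u = encode_sdp d' A0 As"
      using uB by (auto simp: B_def)
    then show ?thesis using ud by (auto simp: sdp_word_def encode_sdp_def)
  qed
  have header: "\<exists>d n xs. u = real d # real n # xs \<and> d \<le> length u \<and> n \<le> length u" if "u \<in> B" for u
  proof -
    obtain d A0 As where "sdp_instance d A0 As" "u = encode_sdp d A0 As"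
      using \<open>u \<in> B\<close> by (auto simp: B_def)
    then interpret sdp_word d A0 As u "length As" by unfold_locales auto
    show ?thesis using size_bounds u unfolding encode_sdp_def by blast
  qed
  have F_iff: "u \<in> F \<longleftrightarrow> (\<exists>x. psd d (pencil n (entry u d) x))"
    if ud: "u \<in> B" "u = real d # real n # xs" for u d n xs
  proof
    assume "u \<in> F"
    then obtain d' A0 As where *: "sdp_instance d' A0 As" "u = encode_sdp d' A0 As"
      "psd_cone d' \<inter> affine_space d' A0 As \<noteq> {}" by (auto simp: F_def)
    then have "d' = d" "length As = n" using ud(2) by (auto simp: encode_sdp_def)
    then show "\<exists>x. psd d (pencil n (entry u d) x)" using feasible_iff[OF *(1)] * by auto
  next
    assume feas: "\<exists>x. psd d (pencil n (entry u d) x)"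
    obtain A0 As where "sdp_word d A0 As u n" using word[OF ud] by blast
    then interpret sdp_word d A0 As u n .
    have "psd_cone d \<inter> affine_space d A0 As \<noteq> {}" using feas feasible_iff[OF inst] by (simp add: u n)
    then show "u \<in> F" using inst u by (auto simp: F_def)
  qed
  have "(B, F) \<in> NP_R"
  proof (rule NP_R_rexpI[where q = "[:0, 2:]" and e = feasible_expr, OF FB header])
    fix u d n xs assume u: "u \<in> B" "u = real d # real n # xs"
    obtain A0 As where "sdp_word d A0 As u n" using word[OF u] by blast
    then show "u \<in> F \<longleftrightarrow> (\<exists>w. length w \<le> poly [:0, 2:] (length u) \<and>
        rval feasible_expr (header d n) (padded (pair_word u w)) \<le> 0)"
      using sdp_word.feasible_witness_iff F_iff[OF u] by blast
  qed
  moreover have "(B, B - F) \<in> NP_R"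
  proof (rule NP_R_rexpI[where q = "[:0, 2:] * [:1, 1:]" and e = infeasible_expr, OF _ header])
    fix u d n xs assume u: "u \<in> B" "u = real d # real n # xs"
    obtain A0 As where "sdp_word d A0 As u n" using word[OF u] by blast
    then show "u \<in> B - F \<longleftrightarrow> (\<exists>w. length w \<le> poly ([:0, 2:] * [:1, 1:]) (length u) \<and>
        rval infeasible_expr (header d n) (padded (pair_word u w)) \<le> 0)"
      using sdp_word.infeasible_witness_iff F_iff[OF u] u(1) by blast
  qed auto
  ultimately show ?thesis using FB by (simp add: SDP coNP_R_def complement_def)
qed

end
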